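(* Let $S$ be a recurrent specular set on the finite alphabet $A$ relative to the involution $\theta$. For any nonempty $w\in S$, the set $\mathcal{R}_S(w)$ of right return words to $w$ in $S$ is a basis of the even subgroup of $G_\theta$ (that is, the even subgroup is a free group and $\mathcal{R}_S(w)$ is a basis of this free group).
   Context: Words are over a finite alphabet $A$; $\varepsilon$ is the empty word. A set $S$ of words on $A$ is factorial if it contains $A$ and all the factors of its elements. For $w\in S$ let $L(w)=\{a\in A\mid aw\in S\}$, $R(w)=\{a\in A\mid wa\in S\}$, $B(w)=\{(a,b)\in A\times A\mid awb\in S\}$. A factorial set $S$ is biextendable if $B(w)\neq\emptyset$ for all $w\in S$. The extension graph $\mathcal{E}(w)$ is the undirected graph whose vertex set is the disjoint union of $L(w)$ and $R(w)$ and whose edges are the pairs in $B(w)$. A biextendable set $S$ is a tree set of characteristic $c$ if $\mathcal{E}(w)$ is a tree for every nonempty $w\in S$ and $\mathcal{E}(\varepsilon)$ is a disjoint union of $c$ trees. Let $\theta$ be an involution on $A$ (possibly with fixed points) and let $G_\theta$ be the group generated by $A$ with relations $a\theta(a)=1$, $a\in A$ (so $a^{-1}=\theta(a)$). A word is reduced if it has no factor $a\theta(a)$ with $a\in A$; every element of $G_\theta$ is represented by a unique reduced word, and reduced words are identified with elements of $G_\theta$. A laminary set on $A$ relative to $\theta$ is a biextendable set of reduced words closed under taking inverses. A specular set is a laminary set which is a tree set of characteristic $2$. A set $S\ne\{\varepsilon\}$ is recurrent if it is factorial and for all $u,w\in S$ there is $v\in S$ with $uvw\in S$. In a specular set $S$,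 each letter $a\in A$ occurs exactly twice as a vertex of $\mathcal{E}(\varepsilon)$, once in $L(\varepsilon)$ and once in $R(\varepsilon)$. The letter $a$ is even if its two occurrences lie in the same tree of $\mathcal{E}(\varepsilon)$, and odd otherwise. A word is even if it has an even number of (occurrences of) odd letters, and odd otherwise. The even subgroup is the subgroup of $G_\theta$ formed by the elements represented by even words. A complete return word to $w$ is a word of $S$ having $w$ as a proper prefix and as a proper suffix, and such that $w$ is not an internal factor of it ($v$ is an internal factor of $y$ if $y=uvu'$ with $u,u'$ nonempty). A right return word to $w$ in $S$ is a word $y$ such that $wy$ is a complete return word to $w$. *)

theory Defs
  imports "HOL-Algebra.Group" "HOL-Library.Sublist"
begin

section \<open>Factorial sets of words\<close>

text \<open>
  A letter is a value of type \<open>'a\<close>, the alphabet is a set \<open>A\<close> of letters, and words are lists.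
  Factors, prefixes and suffixes are those of \<^theory>\<open>HOL-Library.Sublist\<close>
  (there, \<^const>\<open>sublist\<close> means contiguous factor).
\<close>

definition factorial_set :: "'a set \<Rightarrow> 'a list set \<Rightarrow> bool" where
  "factorial_set A S \<longleftrightarrow>
     S \<subseteq> lists A \<and> (\<forall>a\<in>A. [a] \<in> S) \<and> (\<forall>w\<in>S. \<forall>u. sublist u w \<longrightarrow> u \<in> S)"

definition left_ext :: "'a set \<Rightarrow> 'a list set \<Rightarrow> 'a list \<Rightarrow> 'a set" where
  "left_ext A S w = {a \<in> A. a # w \<in> S}"

definition right_ext :: "'a set \<Rightarrow> 'a list set \<Rightarrow> 'a list \<Rightarrow> 'a set" where
  "right_ext A S w = {a \<in> A. w @ [a] \<in> S}"

definition bi_ext :: "'a set \<Rightarrow> 'a list set \<Rightarrow> 'a list \<Rightarrow> ('a \<times> 'a) set" where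
  "bi_ext A S w = {(a, b) \<in> A \<times> A. a # w @ [b] \<in> S}"

definition biextendable :: "'a set \<Rightarrow> 'a list set \<Rightarrow> bool" where
  "biextendable A S \<longleftrightarrow> factorial_set A S \<and> (\<forall>w\<in>S. bi_ext A S w \<noteq> {})"

definition recurrent :: "'a set \<Rightarrow> 'a list set \<Rightarrow> bool" where
  "recurrent A S \<longleftrightarrow>
     S \<noteq> {[]} \<and> factorial_set A S \<and> (\<forall>u\<in>S. \<forall>w\<in>S. \<exists>v\<in>S. u @ v @ w \<in> S)"


section \<open>Undirected graphs and trees\<close>

text \<open>
  An undirected graph is a pair of a vertex set and a set of edges, each edge being the set of
  its two ends.  (The digraph trees of the AFP entry \<open>Graph_Theory\<close> only exclude directed
  cycles, so they do not serve here.)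
\<close>

type_synonym 'v ugraph = "'v set \<times> 'v set set"

definition connected_in :: "'v ugraph \<Rightarrow> 'v \<Rightarrow> 'v \<Rightarrow> bool" where
  "connected_in G x y \<longleftrightarrow> (x, y) \<in> {(u, v). {u, v} \<in> snd G}\<^sup>*"

definition graph_cycle :: "'v ugraph \<Rightarrow> 'v list \<Rightarrow> bool" where
  "graph_cycle G p \<longleftrightarrow>
     3 \<le> length p \<and> distinct p \<and>
     (\<forall>i. Suc i < length p \<longrightarrow> {p ! i, p ! Suc i} \<in> snd G) \<and> {last p, hd p} \<in> snd G"

definition is_tree :: "'v ugraph \<Rightarrow> bool" where
  "is_tree G \<longleftrightarrow>
     fst G \<noteq> {} \<and> (\<forall>x\<in>fst G. \<forall>y\<in>fst G. connected_in G x y) \<and> (\<nexists>p. graph_cycle G p)"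

definition components :: "'v ugraph \<Rightarrow> 'v set set" where
  "components G = (\<lambda>x. {y \<in> fst G. connected_in G x y}) ` fst G"

definition induced :: "'v ugraph \<Rightarrow> 'v set \<Rightarrow> 'v ugraph" where
  "induced G C = (C, {e \<in> snd G. e \<subseteq> C})"

definition disjoint_union_of_trees :: "nat \<Rightarrow> 'v ugraph \<Rightarrow> bool" where
  "disjoint_union_of_trees c G \<longleftrightarrow>
     finite (components G) \<and> card (components G) = c \<and>
     (\<forall>C\<in>components G. is_tree (induced G C))"

definition extension_graph :: "'a set \<Rightarrow> 'a list set \<Rightarrow> 'a list \<Rightarrow> ('a + 'a) ugraph" where
  "extension_graph A S w =
     (left_ext A S w <+> right_ext A S w, {{Inl a, Inr b} | a b. (a, b) \<in> bi_ext A S w})"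

definition tree_set :: "'a set \<Rightarrow> nat \<Rightarrow> 'a list set \<Rightarrow> bool" where
  "tree_set A c S \<longleftrightarrow>
     biextendable A S \<and>
     (\<forall>w\<in>S. w \<noteq> [] \<longrightarrow> is_tree (extension_graph A S w)) \<and>
     disjoint_union_of_trees c (extension_graph A S [])"


section \<open>Specular sets\<close>

definition involution_on :: "'a set \<Rightarrow> ('a \<Rightarrow> 'a) \<Rightarrow> bool" where
  "involution_on A \<theta> \<longleftrightarrow> (\<forall>a\<in>A. \<theta> a \<in> A \<and> \<theta> (\<theta> a) = a)"

definition reduced_word :: "'a set \<Rightarrow> ('a \<Rightarrow> 'a) \<Rightarrow> 'a list \<Rightarrow> bool" where
  "reduced_word A \<theta> w \<longleftrightarrow> w \<in> lists A \<and> (\<forall>a\<in>A. \<not> sublist [a, \<theta> a] w)"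

text \<open>Since \<open>\<theta> a\<close> is the inverse of \<open>a\<close>, the inverse of a word is as follows.\<close>

definition word_inverse :: "('a \<Rightarrow> 'a) \<Rightarrow> 'a list \<Rightarrow> 'a list" where
  "word_inverse \<theta> w = rev (map \<theta> w)"

definition laminary_set :: "'a set \<Rightarrow> ('a \<Rightarrow> 'a) \<Rightarrow> 'a list set \<Rightarrow> bool" where
  "laminary_set A \<theta> S \<longleftrightarrow>
     biextendable A S \<and> (\<forall>w\<in>S. reduced_word A \<theta> w) \<and> (\<forall>w\<in>S. word_inverse \<theta> w \<in> S)"

definition specular_set :: "'a set \<Rightarrow> ('a \<Rightarrow> 'a) \<Rightarrow> 'a list set \<Rightarrow> bool" where
  "specular_set A \<theta> S \<longleftrightarrow> laminary_set A \<theta> S \<and> tree_set A 2 S"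

text \<open>
  The trees of \<open>extension_graph A S []\<close> are its components; \<open>Inl a\<close> and \<open>Inr a\<close>
  are the two occurrences of the letter \<open>a\<close> as a vertex.
\<close>

definition even_letter :: "'a set \<Rightarrow> 'a list set \<Rightarrow> 'a \<Rightarrow> bool" where
  "even_letter A S a \<longleftrightarrow> (\<exists>C\<in>components (extension_graph A S []). Inl a \<in> C \<and> Inr a \<in> C)"

definition even_word :: "'a set \<Rightarrow> 'a list set \<Rightarrow> 'a list \<Rightarrow> bool" where
  "even_word A S w \<longleftrightarrow> even (length (filter (\<lambda>a. \<not> even_letter A S a) w))"


section \<open>Return words\<close>

definition internal_factor :: "'a list \<Rightarrow> 'a list \<Rightarrow> bool" where
  "internal_factor v y \<longleftrightarrow> (\<exists>u u'. y = u @ v @ u' \<and> u \<noteq> [] \<and> u' \<noteq> [])"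

definition complete_return_words :: "'a list set \<Rightarrow> 'a list \<Rightarrow> 'a list set" where
  "complete_return_words S w =
     {x \<in> S. strict_prefix w x \<and> strict_suffix w x \<and> \<not> internal_factor w x}"

definition right_return_words :: "'a list set \<Rightarrow> 'a list \<Rightarrow> 'a list set" where
  "right_return_words S w = {y. w @ y \<in> complete_return_words S w}"


section \<open>Groups given by generators and relations\<close>

text \<open>
  A group word over a set \<open>X\<close> of generators is a list of pairs \<open>(x, e)\<close> with \<open>x \<in> X\<close>;
  \<open>(x, True)\<close> stands for \<open>x\<close> and \<open>(x, False)\<close> for its formal inverse.
  The relation \<open>pres_eq X R\<close> is the congruence on group words generated by
  the cancellation of a generator with its formal inverse and by \<open>r = 1\<close> for \<open>r \<in> R\<close>.
\<close>

type_synonym 'x gword = "('x \<times> bool) list"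

abbreviation gwords :: "'x set \<Rightarrow> 'x gword set" where
  "gwords X \<equiv> lists (X \<times> UNIV)"

inductive pres_eq :: "'x set \<Rightarrow> 'x gword set \<Rightarrow> 'x gword \<Rightarrow> 'x gword \<Rightarrow> bool"
  for X R where
  refl: "u \<in> gwords X \<Longrightarrow> pres_eq X R u u"
| sym: "pres_eq X R u v \<Longrightarrow> pres_eq X R v u"
| trans: "pres_eq X R u v \<Longrightarrow> pres_eq X R v w \<Longrightarrow> pres_eq X R u w"
| cancel: "u \<in> gwords X \<Longrightarrow> v \<in> gwords X \<Longrightarrow> x \<in> X \<Longrightarrow>
    pres_eq X R (u @ [(x, e), (x, \<not> e)] @ v) (u @ v)"
| relator: "u \<in> gwords X \<Longrightarrow> v \<in> gwords X \<Longrightarrow> r \<in> R \<Longrightarrow> r \<in> gwords X \<Longrightarrow>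
    pres_eq X R (u @ r @ v) (u @ v)"

definition pres_class :: "'x set \<Rightarrow> 'x gword set \<Rightarrow> 'x gword \<Rightarrow> 'x gword set" where
  "pres_class X R u = {v. pres_eq X R u v}"

definition presented_group :: "'x set \<Rightarrow> 'x gword set \<Rightarrow> 'x gword set monoid" where
  "presented_group X R =
     \<lparr>carrier = pres_class X R ` gwords X,
      mult = (\<lambda>P Q. \<Union>u\<in>P. \<Union>v\<in>Q. pres_class X R (u @ v)),
      one = pres_class X R []\<rparr>"

lemma pres_eq_gwords: "pres_eq X R u v \<Longrightarrow> u \<in> gwords X \<and> v \<in> gwords X"
  by (induction rule: pres_eq.induct) auto

lemma pres_eq_append_left:
  "pres_eq X R u v \<Longrightarrow> p \<in> gwords X \<Longrightarrow> pres_eq X R (p @ u) (p @ v)"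
proof (induction rule: pres_eq.induct)
  case (refl u)
  then show ?case by (simp add: pres_eq.refl)
next
  case (sym u v)
  then show ?case by (simp add: pres_eq.sym)
next
  case (trans u v w)
  then show ?case using pres_eq.trans by blast
next
  case (cancel u v x e)
  then show ?case using pres_eq.cancel[of "p @ u" X v x R e] by simp
next
  case (relator u v r)
  then show ?case using pres_eq.relator[of "p @ u" X v r R] by simp
qed

lemma pres_eq_append_right:
  "pres_eq X R u v \<Longrightarrow> p \<in> gwords X \<Longrightarrow> pres_eq X R (u @ p) (v @ p)"
proof (induction rule: pres_eq.induct)
  case (refl u)
  then show ?case by (simp add: pres_eq.refl)
next
  case (sym u v)
  then show ?case by (simp add: pres_eq.sym)
next
  case (trans u v w)
  then show ?case using pres_eq.trans by blast
next
  case (cancel u v x e)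
  then show ?case using pres_eq.cancel[of u X "v @ p" x R e] by simp
next
  case (relator u v r)
  then show ?case using pres_eq.relator[of u X "v @ p" r R] by simp
qed

lemma pres_eq_append:
  assumes "pres_eq X R u u'" "pres_eq X R v v'"
  shows "pres_eq X R (u @ v) (u' @ v')"
proof (rule pres_eq.trans)
  show "pres_eq X R (u @ v) (u' @ v)"
    using assms pres_eq_gwords[OF assms(2)] by (simp add: pres_eq_append_right)
  show "pres_eq X R (u' @ v) (u' @ v')"
    using assms pres_eq_gwords[OF assms(1)] by (simp add: pres_eq_append_left)
qed

lemma pres_class_eq_iff:
  assumes "u \<in> gwords X"
  shows "pres_class X R u = pres_class X R v \<longleftrightarrow> pres_eq X R u v"
proof
  assume "pres_class X R u = pres_class X R v"
  then have "u \<in> pres_class X R v"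
    using pres_eq.refl[OF assms, of R] by (auto simp: pres_class_def)
  then show "pres_eq X R u v" by (simp add: pres_class_def pres_eq.sym)
next
  assume "pres_eq X R u v"
  then have "pres_eq X R u t \<longleftrightarrow> pres_eq X R v t" for t
    using pres_eq.trans[of X R u v t] pres_eq.trans[of X R v u t] pres_eq.sym[of X R u v] by iprover
  then show "pres_class X R u = pres_class X R v" by (simp add: pres_class_def)
qed

lemma presented_group_mult:
  assumes "u \<in> gwords X" "v \<in> gwords X"
  shows "pres_class X R u \<otimes>\<^bsub>presented_group X R\<^esub> pres_class X R v = pres_class X R (u @ v)"
proof -
  have "pres_class X R (u' @ v') = pres_class X R (u @ v)"
    if "u' \<in> pres_class X R u" "v' \<in> pres_class X R v" for u' v'
  proof -
    have "pres_eq X R (u @ v) (u' @ v')"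
      using that by (simp add: pres_class_def pres_eq_append)
    then show ?thesis using assms pres_class_eq_iff[of "u @ v" X R "u' @ v'"] by simp
  qed
  moreover have "u \<in> pres_class X R u" "v \<in> pres_class X R v"
    using assms by (simp_all add: pres_class_def pres_eq.refl)
  ultimately have "(\<Union>u'\<in>pres_class X R u. \<Union>v'\<in>pres_class X R v. pres_class X R (u' @ v'))
      = pres_class X R (u @ v)"
    by blast
  then show ?thesis by (simp add: presented_group_def)
qed

lemma pres_eq_inverse:
  "u \<in> gwords X \<Longrightarrow> pres_eq X R (rev (map (\<lambda>(x, e). (x, \<not> e)) u) @ u) []"
proof (induction u)
  case Nil
  then show ?case by (auto intro: pres_eq.refl)
next
  case (Cons p u)
  obtain x e where p: "p = (x, e)" by (cases p)
  let ?i = "rev (map (\<lambda>(x, e). (x, \<not> e)) u)"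
  have "x \<in> X" "u \<in> gwords X" "?i \<in> gwords X" using Cons.prems p by auto
  then have "pres_eq X R (?i @ [(x, \<not> e), (x, \<not> \<not> e)] @ u) (?i @ u)"
    by (intro pres_eq.cancel)
  from pres_eq.trans[OF this Cons.IH[OF \<open>u \<in> gwords X\<close>]] show ?case by (simp add: p)
qed

lemma group_presented_group: "group (presented_group X R)"
proof (rule groupI)
  let ?G = "presented_group X R"
  have carr: "carrier ?G = pres_class X R ` gwords X"
    and one: "\<one>\<^bsub>?G\<^esub> = pres_class X R []"
    by (auto simp: presented_group_def)
  show "\<one>\<^bsub>?G\<^esub> \<in> carrier ?G" by (auto simp: carr one)
  show "P \<otimes>\<^bsub>?G\<^esub> Q \<in> carrier ?G" if "P \<in> carrier ?G" "Q \<in> carrier ?G" for P Q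
  proof -
    obtain u v where uv: "u \<in> gwords X" "v \<in> gwords X"
      "P = pres_class X R u" "Q = pres_class X R v"
      using \<open>P \<in> carrier ?G\<close> \<open>Q \<in> carrier ?G\<close> unfolding carr by blast
    then have "u @ v \<in> gwords X" by (simp only: append_in_lists_conv)
    then show ?thesis using uv unfolding carr by (simp only: presented_group_mult imageI)
  qed
  show "P \<otimes>\<^bsub>?G\<^esub> Q \<otimes>\<^bsub>?G\<^esub> T = P \<otimes>\<^bsub>?G\<^esub> (Q \<otimes>\<^bsub>?G\<^esub> T)"
    if "P \<in> carrier ?G" "Q \<in> carrier ?G" "T \<in> carrier ?G" for P Q T
  proof -
    obtain u v t where "u \<in> gwords X" "v \<in> gwords X" "t \<in> gwords X"
      "P = pres_class X R u" "Q = pres_class X R v" "T = pres_class X R t"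
      using \<open>P \<in> carrier ?G\<close> \<open>Q \<in> carrier ?G\<close> \<open>T \<in> carrier ?G\<close> unfolding carr by blast
    then show ?thesis
      by (simp only: presented_group_mult append_in_lists_conv append_assoc)
  qed
  show "\<one>\<^bsub>?G\<^esub> \<otimes>\<^bsub>?G\<^esub> P = P" if "P \<in> carrier ?G" for P
  proof -
    obtain u where "u \<in> gwords X" "P = pres_class X R u"
      using \<open>P \<in> carrier ?G\<close> unfolding carr by blast
    then show ?thesis using presented_group_mult[of "[]" X u R] by (simp add: one)
  qed
  show "\<exists>Q\<in>carrier ?G. Q \<otimes>\<^bsub>?G\<^esub> P = \<one>\<^bsub>?G\<^esub>" if "P \<in> carrier ?G" for P
  proof -
    obtain u where u: "u \<in> gwords X" "P = pres_class X R u"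
      using \<open>P \<in> carrier ?G\<close> unfolding carr by blast
    let ?i = "rev (map (\<lambda>(x, e). (x, \<not> e)) u)"
    have i: "?i \<in> gwords X" using u by auto
    have iu: "?i @ u \<in> gwords X" using i u(1) by (metis append_in_lists_conv)
    have "pres_class X R ?i \<otimes>\<^bsub>?G\<^esub> P = \<one>\<^bsub>?G\<^esub>"
      using presented_group_mult[OF i u(1), of R] pres_eq_inverse[OF u(1), of R]
        pres_class_eq_iff[OF iu, of R "[]"]
      by (simp add: u(2) one)
    then show ?thesis using i unfolding carr by blast
  qed
qed


section \<open>Free groups and bases\<close>

definition free_group :: "'x set \<Rightarrow> 'x gword set monoid" where
  "free_group X = presented_group X {}"

text \<open>
  \<open>H\<close> is a free group with basis \<open>X\<close> if the homomorphism from the free group on \<open>X\<close> to \<open>H\<close>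
  that extends the inclusion of \<open>X\<close> is an isomorphism.
\<close>

definition is_basis :: "('g, 'm) monoid_scheme \<Rightarrow> 'g set \<Rightarrow> bool" where
  "is_basis H X \<longleftrightarrow>
     X \<subseteq> carrier H \<and>
     (\<exists>h \<in> iso (free_group X) H. \<forall>x\<in>X. h (pres_class X {} [(x, True)]) = x)"


section \<open>The group of an involution and its even subgroup\<close>

definition specular_relators :: "'a set \<Rightarrow> ('a \<Rightarrow> 'a) \<Rightarrow> 'a gword set" where
  "specular_relators A \<theta> = {[(a, True), (\<theta> a, True)] | a. a \<in> A}"

definition specular_group :: "'a set \<Rightarrow> ('a \<Rightarrow> 'a) \<Rightarrow> 'a gword set monoid" where
  "specular_group A \<theta> = presented_group A (specular_relators A \<theta>)"

text \<open>The element of the group represented by a word over \<open>A\<close>:\<close>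

definition word_elem :: "'a set \<Rightarrow> ('a \<Rightarrow> 'a) \<Rightarrow> 'a list \<Rightarrow> 'a gword set" where
  "word_elem A \<theta> w = pres_class A (specular_relators A \<theta>) (map (\<lambda>a. (a, True)) w)"

definition even_subgroup ::
    "'a set \<Rightarrow> ('a \<Rightarrow> 'a) \<Rightarrow> 'a list set \<Rightarrow> 'a gword set monoid" where
  "even_subgroup A \<theta> S =
     (specular_group A \<theta>)\<lparr>carrier := word_elem A \<theta> ` {u \<in> lists A. even_word A S u}\<rparr>"

end

theory Submission
  imports Defs "HOL-Algebra.Generated_Groups"
begin

text \<open>
  A labelling of the return words to \<open>w\<close> in a group \<open>K\<close> is a labelling of the long words of \<open>S\<close>: a word
  gets the label of the return word that it completes, if any.  Since the extension graphs are
  acyclic, the labels \<open>g (a v b)\<close> factor as \<open>\<phi> (a v) \<phi>' (v b)\<close>, so the labelling is cohomologous to one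
  of shorter words and finally of letters.  Inversion exchanges the two trees of the empty word, so
  a labelling of the letters always extends to a homomorphism from the even subgroup to \<open>K\<close>.  With
  \<open>K\<close> of order 2, this bounds the number of return words by that of letters; with \<open>K\<close> free on the
  return words, it shows that they are free generators of the subgroup \<open>H\<close> that they generate.
  Finally, every long word of \<open>S\<close> contains \<open>w\<close>, hence determines the coset \<open>H s\<close>, where \<open>s\<close> is what follows
  the last occurrence of \<open>w\<close>.  By connectedness this coset depends only on the last letter, and only
  on its tree in the extension graph of the empty word, so even words fix \<open>H\<close>.
\<close>

section \<open>Acyclic graphs\<close>

lemma connected_in_refl: "connected_in G x x"
  by (simp add: connected_in_def)

lemma connected_in_edge: "{x, y} \<in> snd G \<Longrightarrow> connected_in G x y"
  by (auto simp: connected_in_def)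

lemma connected_in_trans: "connected_in G x y \<Longrightarrow> connected_in G y z \<Longrightarrow> connected_in G x z"
  unfolding connected_in_def by (rule rtrancl_trans)

lemma connected_in_sym:
  assumes "connected_in G x y"
  shows "connected_in G y x"
proof -
  have "sym {(u, v). {u, v} \<in> snd G}"
    by (auto simp: sym_def insert_commute)
  then show ?thesis
    using assms unfolding connected_in_def by (meson sym_rtrancl symD)
qed

lemma connected_in_invariant:
  assumes "connected_in G x y" and "\<And>u v. {u, v} \<in> snd G \<Longrightarrow> \<kappa> u = \<kappa> v"
  shows "\<kappa> x = \<kappa> y"
  using assms(1) unfolding connected_in_def
  by (induction rule: rtrancl_induct) (auto dest: assms(2))

text \<open>If the new vertex already lies on the path, the path is cut there, so no vertex is
  repeated.\<close>

lemma rtrancl_distinct_path: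
  assumes "(x, y) \<in> r\<^sup>*"
  shows "\<exists>p. p \<noteq> [] \<and> distinct p \<and> hd p = x \<and> last p = y \<and> successively (\<lambda>u v. (u, v) \<in> r) p"
  using assms
proof (induction rule: converse_rtrancl_induct)
  case base
  then show ?case by (intro exI[of _ "[y]"]) simp
next
  case (step x x')
  then obtain p where p: "p \<noteq> []" "distinct p" "hd p = x'" "last p = y"
    "successively (\<lambda>u v. (u, v) \<in> r) p"
    by blast
  show ?case
  proof (cases "x \<in> set p")
    case True
    then obtain p1 p2 where "p = p1 @ x # p2" by (meson split_list)
    then show ?thesis using p
      by (intro exI[of _ "x # p2"]) (auto simp: successively_append_iff split: if_splits)
  next
    case False
    then show ?thesis using p step.hyps(1)
      by (intro exI[of _ "x # p"]) (auto simp: successively_Cons)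
  qed
qed

text \<open>A simple path from \<open>x\<close> to \<open>y\<close> that avoids the edge has at
  least three vertices, since two would use the removed edge; the edge then closes it to a
  cycle.\<close>

lemma acyclic_remove_edge:
  assumes "\<nexists>p. graph_cycle (V, E) p" and "{x, y} \<in> E" and "x \<noteq> y"
  shows "\<not> connected_in (V', E - {{x, y}}) x y"
proof
  assume "connected_in (V', E - {{x, y}}) x y"
  then obtain p where p: "p \<noteq> []" "distinct p" "hd p = x" "last p = y"
    and s: "successively (\<lambda>u v. (u, v) \<in> {(u, v). {u, v} \<in> E - {{x, y}}}) p"
    unfolding connected_in_def by (auto dest: rtrancl_distinct_path)
  have "length p \<noteq> 1"
    using p \<open>x \<noteq> y\<close> by (auto simp: length_Suc_conv)
  moreover have "length p \<noteq> 2"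
    using p s by (auto simp: length_Suc_conv numeral_2_eq_2)
  ultimately have "3 \<le> length p"
    using p(1) by (cases "length p") auto
  moreover have "\<forall>i. Suc i < length p \<longrightarrow> {p ! i, p ! Suc i} \<in> E"
    using s by (auto simp: successively_conv_nth)
  ultimately have "graph_cycle (V, E) p"
    using p assms(2) by (auto simp: graph_cycle_def insert_commute)
  then show False using assms(1) by blast
qed

lemma graph_cycle_mono: "graph_cycle (V, E) p \<Longrightarrow> E \<subseteq> E' \<Longrightarrow> graph_cycle (V', E') p"
  by (auto simp: graph_cycle_def)

text \<open>Induction on the edges. A new edge joins two distinct components of the old graph, so
  the values on one of them can be twisted to suit it. The order of factors is respected, which
  admits nonabelian groups.\<close>

lemma (in group) acyclic_factorization:
  fixes B :: "('c \<times> 'd) set" and g :: "'c \<times> 'd \<Rightarrow> 'a"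
  assumes "finite B" and "\<nexists>p. graph_cycle (V, {{Inl a, Inr b} | a b. (a, b) \<in> B}) p"
    and "\<And>e. g e \<in> carrier G"
  shows "\<exists>\<phi>. (\<forall>v. \<phi> v \<in> carrier G) \<and> (\<forall>a b. (a, b) \<in> B \<longrightarrow> g (a, b) = \<phi> (Inl a) \<otimes> \<phi> (Inr b))"
  using assms(1,2)
proof (induction B rule: finite_induct)
  case empty
  show ?case by (intro exI[of _ "\<lambda>_. \<one>"]) simp
next
  case (insert e B)
  obtain a b where e: "e = (a, b)" by (cases e)
  let ?E = "\<lambda>B. {{Inl a, Inr b} | a b. (a, b) \<in> B} :: ('c + 'd) set set"
  have sub: "?E B \<subseteq> ?E (insert e B)" by blast
  have "\<nexists>p. graph_cycle (V, ?E B) p"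
    using insert.prems graph_cycle_mono[OF _ sub, of V _ V] by iprover
  then obtain \<phi> where \<phi>: "\<And>v. \<phi> v \<in> carrier G"
    "\<And>a b. (a, b) \<in> B \<Longrightarrow> g (a, b) = \<phi> (Inl a) \<otimes> \<phi> (Inr b)"
    using insert.IH by blast
  have "?E (insert e B) - {{Inl a, Inr b}} = ?E B"
    using insert.hyps(2) e by (auto simp: doubleton_eq_iff)
  moreover have "{Inl a, Inr b} \<in> ?E (insert e B)" using e by blast
  ultimately have nc: "\<not> connected_in (V, ?E B) (Inl a) (Inr b)"
    using acyclic_remove_edge[OF insert.prems, of "Inl a" "Inr b" V] by simp
  \<comment> \<open>Solves \<open>\<phi> (Inl a) \<otimes> t \<otimes> \<phi> (Inr b) = g (a,
    b)\<close>.\<close>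
  define t where "t = inv \<phi> (Inl a) \<otimes> g (a, b) \<otimes> inv \<phi> (Inr b)"
  have t: "t \<in> carrier G" using \<phi>(1) assms(3) by (simp add: t_def)
  \<comment> \<open>Only the component of \<open>Inl a\<close> is twisted, and \<open>Inr b\<close>
    lies outside it. An old edge has both ends inside or both outside; inside, \<open>t\<close> and
    \<open>inv t\<close> meet and cancel.\<close>
  define \<phi>' where "\<phi>' v = (if connected_in (V, ?E B) (Inl a) v
      then (case v of Inl _ \<Rightarrow> \<phi> v \<otimes> t | Inr _ \<Rightarrow> inv t \<otimes> \<phi> v) else \<phi> v)" for v
  have "\<phi>' v \<in> carrier G" for v
    using \<phi>(1) t by (auto simp: \<phi>'_def split: sum.split)
  moreover have "g (c, d) = \<phi>' (Inl c) \<otimes> \<phi>' (Inr d)" if "(c, d) \<in> insert e B" for c d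
  proof (cases "(c, d) = e")
    case True
    have "g (a, b) = \<phi> (Inl a) \<otimes> t \<otimes> \<phi> (Inr b)"
      using \<phi>(1) assms(3) unfolding t_def
      by (metis inv_closed l_inv m_assoc m_closed r_inv r_one l_one)
    then show ?thesis using True nc e by (simp add: \<phi>'_def connected_in_refl)
  next
    case False
    then have cd: "(c, d) \<in> B" using that by simp
    then have "connected_in (V, ?E B) (Inl c) (Inr d)"
      by (intro connected_in_edge) auto
    then have "connected_in (V, ?E B) (Inl a) (Inl c) \<longleftrightarrow> connected_in (V, ?E B) (Inl a) (Inr d)"
      by (meson connected_in_sym connected_in_trans)
    moreover have "\<phi> (Inl c) \<otimes> t \<otimes> (inv t \<otimes> \<phi> (Inr d)) = \<phi> (Inl c) \<otimes> \<phi> (Inr d)"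
      using \<phi>(1) t by (metis inv_closed l_inv inv_inv m_assoc m_closed r_inv r_one)
    ultimately show ?thesis using \<phi>(2)[OF cd] by (simp add: \<phi>'_def)
  qed
  ultimately show ?case by blast
qed

section \<open>The extension graphs of a specular set\<close>

text \<open>A cycle stays within one component, so it would be a cycle of the tree induced
  there.\<close>

lemma disjoint_union_of_trees_acyclic:
  assumes "disjoint_union_of_trees c G" and "\<And>e. e \<in> snd G \<Longrightarrow> e \<subseteq> fst G"
  shows "\<nexists>p. graph_cycle G p"
proof
  assume "\<exists>p. graph_cycle G p"
  then obtain p where p: "3 \<le> length p" "distinct p"
    "\<And>i. Suc i < length p \<Longrightarrow> {p ! i, p ! Suc i} \<in> snd G" "{last p, hd p} \<in> snd G"
    unfolding graph_cycle_def by blast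
  define C where "C = {y \<in> fst G. connected_in G (p ! 0) y}"
  have C: "p ! i \<in> C" if "i < length p" for i
    using that
  proof (induction i)
    case 0
    have "{p ! 0, p ! Suc 0} \<in> snd G" using p by simp
    then have "p ! 0 \<in> fst G" using assms(2) by blast
    then show ?case by (simp add: C_def connected_in_refl)
  next
    case (Suc i)
    then have "p ! i \<in> C" and e: "{p ! i, p ! Suc i} \<in> snd G" using p(3) by auto
    moreover have "p ! Suc i \<in> fst G" using e assms(2) by blast
    ultimately show ?case
      unfolding C_def by (auto intro: connected_in_trans connected_in_edge)
  qed
  have "p \<noteq> []" using p(1) by auto
  then have "last p \<in> C" "hd p \<in> C" "p ! 0 \<in> C"
    using C by (simp_all add: last_conv_nth hd_conv_nth)
  then have "graph_cycle (induced G C) p"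
    using p C unfolding graph_cycle_def induced_def by auto
  moreover have "C \<in> components G"
    using \<open>p ! 0 \<in> C\<close> unfolding components_def C_def by blast
  ultimately show False
    using assms(1) unfolding disjoint_union_of_trees_def is_tree_def by blast
qed

text \<open>Three pairwise unconnected vertices would give three components.\<close>

lemma two_components:
  assumes "finite (components G)" and "card (components G) = 2"
    and "x \<in> fst G" "y \<in> fst G" "z \<in> fst G"
    and "\<not> connected_in G x y" "\<not> connected_in G x z"
  shows "connected_in G y z"
proof (rule ccontr)
  assume nyz: "\<not> connected_in G y z"
  let ?C = "\<lambda>v. {u \<in> fst G. connected_in G v u}"
  have "?C u \<noteq> ?C v" if "v \<in> fst G" "\<not> connected_in G u v" for u v
    using that connected_in_refl[of G v] by blast
  then have "card {?C x, ?C y, ?C z} = 3"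
    using assms nyz by (simp add: card_insert_if)
  moreover have "card {?C x, ?C y, ?C z} \<le> card (components G)"
    using assms unfolding components_def by (intro card_mono) auto
  ultimately show False using assms(2) by simp
qed

text \<open>The group of order 2: exclusive or is addition modulo 2.\<close>

definition bool_group :: "bool monoid" where
  "bool_group = \<lparr>carrier = UNIV, mult = (\<noteq>), one = False\<rparr>"

lemma group_bool_group: "group bool_group"
  by (rule groupI) (auto simp: bool_group_def)

locale specular =
  fixes A :: "'a set" and \<theta> :: "'a \<Rightarrow> 'a" and S :: "'a list set"
  assumes finite_alphabet: "finite A"
    and involution: "involution_on A \<theta>"
    and specular: "specular_set A \<theta> S"
begin

abbreviation E :: "'a list \<Rightarrow> ('a + 'a) ugraph" where
  "E v \<equiv> extension_graph A S v"

lemma biextendable: "biextendable A S"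
  using specular by (simp add: specular_set_def laminary_set_def)

lemma factor: "v \<in> S \<Longrightarrow> sublist u v \<Longrightarrow> u \<in> S"
  using biextendable unfolding biextendable_def factorial_set_def by blast

lemma factor_appendD: "u @ v @ t \<in> S \<Longrightarrow> v \<in> S"
  by (rule factor) (auto simp: sublist_def)

lemma suffix_closed: "u @ v \<in> S \<Longrightarrow> v \<in> S"
  using factor_appendD[of u v "[]"] by simp

lemma prefix_closed: "u @ v \<in> S \<Longrightarrow> u \<in> S"
  using factor_appendD[of "[]" u v] by simp

lemma tl_closed: "a # v \<in> S \<Longrightarrow> v \<in> S"
  using suffix_closed[of "[a]" v] by simp

lemma letter: "a \<in> A \<Longrightarrow> [a] \<in> S"
  using biextendable unfolding biextendable_def factorial_set_def by blast

lemma alphabet: "v \<in> S \<Longrightarrow> set v \<subseteq> A"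
  using biextendable unfolding biextendable_def factorial_set_def by (auto simp: lists_eq_set)

lemma extend_left: "v \<in> S \<Longrightarrow> \<exists>a. a # v \<in> S"
proof -
  assume "v \<in> S"
  then obtain a b where "a # v @ [b] \<in> S"
    using biextendable unfolding biextendable_def bi_ext_def by blast
  then show ?thesis using prefix_closed[of "a # v" "[b]"] by auto
qed

lemma extend_left_length: "v \<in> S \<Longrightarrow> \<exists>t. length t = n \<and> t @ v \<in> S"
proof (induction n)
  case (Suc n)
  then obtain t where "length t = n" "t @ v \<in> S" by blast
  then show ?case using extend_left[of "t @ v"] by (metis append_Cons length_Cons)
qed simp

lemma theta_closed: "a \<in> A \<Longrightarrow> \<theta> a \<in> A"
  and theta_theta: "a \<in> A \<Longrightarrow> \<theta> (\<theta> a) = a"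
  using involution by (auto simp: involution_on_def)

lemma two_letters_inverse: "[a, b] \<in> S \<Longrightarrow> [\<theta> b, \<theta> a] \<in> S"
  using specular by (force simp: specular_set_def laminary_set_def word_inverse_def)

lemma two_letters_reduced: "[a, b] \<in> S \<Longrightarrow> b \<noteq> \<theta> a"
  using specular alphabet[of "[a, b]"]
  by (auto simp: specular_set_def laminary_set_def reduced_word_def)

lemma edge_iff: "{x, y} \<in> snd (E v) \<longleftrightarrow>
    (\<exists>a b. a # v @ [b] \<in> S \<and> (x = Inl a \<and> y = Inr b \<or> x = Inr b \<and> y = Inl a))"
  using alphabet by (fastforce simp: extension_graph_def bi_ext_def doubleton_eq_iff)

lemma edges_subset:
  assumes "e \<in> snd (E v)"
  shows "e \<subseteq> fst (E v)"
proof -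
  obtain a b where e: "e = {Inl a, Inr b}" "a \<in> A" "b \<in> A" "a # v @ [b] \<in> S"
    using assms by (auto simp: extension_graph_def bi_ext_def)
  then have "a # v \<in> S" "v @ [b] \<in> S"
    using prefix_closed[of "a # v" "[b]"] tl_closed by auto
  then show ?thesis
    using e by (auto simp: extension_graph_def left_ext_def right_ext_def)
qed

lemma connected: "v \<in> S \<Longrightarrow> v \<noteq> [] \<Longrightarrow> x \<in> fst (E v) \<Longrightarrow> y \<in> fst (E v) \<Longrightarrow> connected_in (E v) x y"
  using specular by (simp add: specular_set_def tree_set_def is_tree_def)

lemma acyclic: "v \<in> S \<Longrightarrow> \<nexists>p. graph_cycle (E v) p"
proof (cases "v = []")
  case True
  then show ?thesis
    using specular disjoint_union_of_trees_acyclic[of 2 "E []"] edges_subset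
    by (simp add: specular_set_def tree_set_def)
next
  case False
  assume "v \<in> S"
  then show ?thesis using specular False by (simp add: specular_set_def tree_set_def is_tree_def)
qed

lemma extension_factorization:
  assumes "group K" and "v \<in> S" and "\<And>x. g x \<in> carrier K"
  shows "\<exists>\<phi>. (\<forall>x. \<phi> x \<in> carrier K) \<and>
    (\<forall>a b. a # v @ [b] \<in> S \<longrightarrow> g (a # v @ [b]) = \<phi> (Inl a) \<otimes>\<^bsub>K\<^esub> \<phi> (Inr b))"
proof -
  have "bi_ext A S v \<subseteq> A \<times> A" by (auto simp: bi_ext_def)
  then have "finite (bi_ext A S v)" using finite_alphabet finite_subset by blast
  then obtain \<phi> where "\<forall>x. \<phi> x \<in> carrier K"
    "\<forall>a b. (a, b) \<in> bi_ext A S v \<longrightarrow> (\<lambda>(a, b). g (a # v @ [b])) (a, b) = \<phi> (Inl a) \<otimes>\<^bsub>K\<^esub> \<phi> (Inr b)"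
    using group.acyclic_factorization[OF assms(1), of "bi_ext A S v" "fst (E v)" "\<lambda>(a, b). g (a # v @ [b])"]
      acyclic[OF assms(2)] assms(3) by (auto simp: extension_graph_def)
  moreover have "(a, b) \<in> bi_ext A S v" if "a # v @ [b] \<in> S" for a b
    using that alphabet[OF that] by (simp add: bi_ext_def)
  ultimately show ?thesis by (intro exI[of _ \<phi>]) auto
qed

lemma empty_word: "v \<in> S \<Longrightarrow> [] \<in> S"
  using prefix_closed[of "[]" v] by simp

text \<open>Inversion maps an edge \<open>(a, b)\<close> of \<open>E []\<close> to the edge \<open>(\<theta> b, \<theta> a)\<close>, without fixing any edge.
  Weighting one edge of each orbit by 1 and the other by 0, and writing the weight as a sum
  of a function of the ends modulo 2, the symmetrised function alternates along the edges.\<close>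

lemma inverse_not_connected:
  assumes "a \<in> A"
  shows "\<not> connected_in (E []) (Inl a) (Inr (\<theta> a))"
proof
  assume conn: "connected_in (E []) (Inl a) (Inr (\<theta> a))"
  \<comment> \<open>\<open>SOME\<close> depends only on the set, which a word shares with its
    inverse, so of two distinct inverse words exactly one gets \<open>True\<close>.\<close>
  define g where "g x = (x = (SOME y. y \<in> {x, word_inverse \<theta> x}))" for x
  have "[] \<in> S" using letter[OF assms] empty_word by blast
  from extension_factorization[OF group_bool_group this, of g] obtain \<phi> where
    \<phi>: "\<And>a b. [a, b] \<in> S \<Longrightarrow> g [a, b] = (\<phi> (Inl a) = (\<not> \<phi> (Inr b)))"
    by (auto simp: bool_group_def)
  \<comment> \<open>The negation at right vertices turns alternation along edges into
    invariance.\<close>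
  define \<kappa> where "\<kappa> v = (case v of Inl a \<Rightarrow> (\<phi> (Inl a) \<noteq> \<phi> (Inr (\<theta> a)))
    | Inr b \<Rightarrow> \<not> (\<phi> (Inr b) \<noteq> \<phi> (Inl (\<theta> b))))" for v
  have edge: "\<kappa> (Inl b) = \<kappa> (Inr c)" if "[b, c] \<in> S" for b c
  proof -
    have bc: "b \<in> A" "c \<in> A" using alphabet[OF that] by auto
    have ne: "[b, c] \<noteq> [\<theta> c, \<theta> b]" using two_letters_reduced[OF that] by auto
    define e where "e = (SOME y. y \<in> {[b, c], [\<theta> c, \<theta> b]})"
    have "e \<in> {[b, c], [\<theta> c, \<theta> b]}"
      unfolding e_def by (rule someI[of _ "[b, c]"]) simp
    moreover have "g [b, c] = ([b, c] = e)"
      by (simp add: g_def e_def word_inverse_def)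
    moreover have "g [\<theta> c, \<theta> b] = ([\<theta> c, \<theta> b] = e)"
      unfolding g_def e_def insert_commute[of "[b, c]"]
      by (simp add: word_inverse_def theta_theta bc)
    ultimately have "g [b, c] \<noteq> g [\<theta> c, \<theta> b]"
      using ne by (metis insert_iff empty_iff)
    then have "(\<phi> (Inl b) = (\<not> \<phi> (Inr c))) \<noteq> (\<phi> (Inl (\<theta> c)) = (\<not> \<phi> (Inr (\<theta> b))))"
      unfolding \<phi>[OF that, symmetric] \<phi>[OF two_letters_inverse[OF that], symmetric] .
    then show ?thesis
      unfolding \<kappa>_def sum.case by blast
  qed
  have "\<kappa> (Inl a) = \<kappa> (Inr (\<theta> a))"
    using conn by (rule connected_in_invariant) (auto simp: edge_iff edge)
  \<comment> \<open>As \<open>\<theta> (\<theta> a) = a\<close>, these two values of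
    \<open>\<kappa>\<close> are negations of each other.\<close>
  then show False using theta_theta[OF assms] by (auto simp: \<kappa>_def)
qed

end

section \<open>Cocycles on a specular set\<close>

context specular
begin

text \<open>A labelling \<open>g\<close> of the words of length \<open>n + 1\<close> of \<open>S\<close> is cohomologous to a labelling of the
  letters: one factorization over the extension graphs of the words of length \<open>n - 1\<close> lowers \<open>n\<close>
  by one.  The map \<open>h\<close> records that \<open>g\<close> does not look beyond the last occurrences of \<open>w\<close>, which
  makes the coboundary constant on the words that end with \<open>w\<close>.\<close>

lemma cocycle_descent:
  fixes K (structure) and g h :: "'a list \<Rightarrow> 'k"
  assumes "group K" and h: "\<And>x. h x \<in> carrier K"
    and h_local: "\<And>a v b. a # v @ [b] \<in> S \<Longrightarrow> sublist w v \<Longrightarrow> h (a # v @ [b]) = h (v @ [b])"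
    and "\<And>x. g x \<in> carrier K"
    and "\<And>a v b. a # v @ [b] \<in> S \<Longrightarrow> length v + 2 = Suc n \<Longrightarrow> sublist w v \<Longrightarrow>
      g (a # v @ [b]) = h (v @ [b])"
  shows "\<exists>\<alpha> \<psi> k. (\<forall>z. \<alpha> z \<in> carrier K) \<and> (\<forall>a. \<psi> a \<in> carrier K) \<and>
    (\<forall>z b. z @ [b] \<in> S \<longrightarrow> length z = n \<longrightarrow> g (z @ [b]) = \<alpha> z \<otimes> \<psi> b \<otimes> inv \<alpha> (tl (z @ [b]))) \<and>
    (\<forall>z. length z = n \<longrightarrow> suffix w z \<longrightarrow> \<alpha> z = k)"
  using assms(4,5)
proof (induction n arbitrary: g)
  case 0
  interpret group K by fact
  \<comment> \<open>For words of one letter, \<open>\<psi>\<close> is \<open>g\<close> itself and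
    the coboundary is trivial.\<close>
  show ?case
    using 0 by (intro exI[of _ "\<lambda>_. \<one>"] exI[of _ "\<lambda>b. g [b]"]) auto
next
  case (Suc n)
  interpret group K by fact
  have "\<exists>\<phi>. (\<forall>x. \<phi> x \<in> carrier K) \<and>
      (v \<in> S \<longrightarrow> (\<forall>a b. a # v @ [b] \<in> S \<longrightarrow> g (a # v @ [b]) = \<phi> (Inl a) \<otimes> \<phi> (Inr b)))" for v
    using extension_factorization[OF \<open>group K\<close>, of v g] Suc.prems(1) by (cases "v \<in> S") auto
  then obtain \<Phi> where \<Phi>: "\<And>v x. \<Phi> v x \<in> carrier K"
    "\<And>a v b. v \<in> S \<Longrightarrow> a # v @ [b] \<in> S \<Longrightarrow> g (a # v @ [b]) = \<Phi> v (Inl a) \<otimes> \<Phi> v (Inr b)"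
    by metis
  \<comment> \<open>If \<open>w\<close> occurs in \<open>v\<close>, the label of
    \<open>a # v @ [b]\<close> is already \<open>h (v @ [b])\<close>; the left factor is then taken
    trivial.\<close>
  define L where "L z = (if sublist w (tl z) then \<one> else \<Phi> (tl z) (Inl (hd z)))" for z
  define R where "R z = (if sublist w (butlast z) then h z else \<Phi> (butlast z) (Inr (last z)))" for z
  \<comment> \<open>Along a word, the right factor of one window meets the left factor of the next;
    their product labels the shorter word that the windows share.\<close>
  define g' where "g' z = R z \<otimes> L z" for z
  have closed: "L z \<in> carrier K" "R z \<in> carrier K" for z
    using \<Phi>(1) h by (auto simp: L_def R_def)
  have g: "g (a # v @ [b]) = L (a # v) \<otimes> R (v @ [b])" if "a # v @ [b] \<in> S" "length v = n" for a v b
  proof -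
    have "v \<in> S" using factor_appendD[of "[a]" v "[b]"] that by simp
    show ?thesis
    proof (cases "sublist w v")
      case True
      then show ?thesis using that Suc.prems(2)[of a v b] h by (simp add: L_def R_def)
    next
      case False
      then show ?thesis using that \<Phi>(2)[OF \<open>v \<in> S\<close>] by (simp add: L_def R_def)
    qed
  qed
  have g'1: "g' x \<in> carrier K" for x
    using closed by (simp add: g'_def)
  have g'2: "g' (a # v @ [b]) = h (v @ [b])"
    if "a # v @ [b] \<in> S" "length v + 2 = Suc n" "sublist w v" for a v b
  proof -
    have "sublist w (v @ [b])" "sublist w (a # v)"
      using that(3) by (auto simp: sublist_Cons_right sublist_append)
    then show ?thesis
      using that h h_local by (simp add: g'_def L_def R_def butlast_append)
  qed
  from Suc.IH[of g', OF g'1 g'2] obtain \<alpha> \<psi> k where ex: "\<forall>z. \<alpha> z \<in> carrier K" "\<forall>a. \<psi> a \<in> carrier K"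
    "\<forall>z b. z @ [b] \<in> S \<longrightarrow> length z = n \<longrightarrow> g' (z @ [b]) = \<alpha> z \<otimes> \<psi> b \<otimes> inv \<alpha> (tl (z @ [b]))"
    "\<forall>z. length z = n \<longrightarrow> suffix w z \<longrightarrow> \<alpha> z = k"
    by blast
  note IH = ex[rule_format]
  define \<beta> where "\<beta> z = L z \<otimes> \<alpha> (tl z)" for z
  have 1: "\<forall>z. \<beta> z \<in> carrier K"
    using closed IH(1) by (simp add: \<beta>_def)
  have 2: "g (z @ [b]) = \<beta> z \<otimes> \<psi> b \<otimes> inv \<beta> (tl (z @ [b]))"
    if "z @ [b] \<in> S" "length z = Suc n" for z b
  proof -
    obtain a v where z: "z = a # v" "length v = n"
      using \<open>length z = Suc n\<close> by (auto simp: length_Suc_conv)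
    have "v @ [b] \<in> S" using that z tl_closed by simp
    then have "R (v @ [b]) \<otimes> L (v @ [b]) = \<alpha> v \<otimes> \<psi> b \<otimes> inv \<alpha> (tl (v @ [b]))"
      using IH(3) z by (simp add: g'_def)
    then have "R (v @ [b]) = \<alpha> v \<otimes> \<psi> b \<otimes> inv \<alpha> (tl (v @ [b])) \<otimes> inv L (v @ [b])"
      by (intro inv_solve_right[THEN iffD2] m_closed inv_closed closed IH(1,2)) simp
    then show ?thesis
      using that z g[of a v b] closed IH(1,2) by (simp add: \<beta>_def m_assoc inv_mult_group)
  qed
  \<comment> \<open>If \<open>w\<close> has length \<open>Suc n\<close>, the only such
    \<open>z\<close> is \<open>w\<close>. Otherwise \<open>w\<close> is a suffix of
    \<open>tl z\<close>, so \<open>L z\<close> is trivial and the constant of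
    \<open>\<alpha>\<close> is inherited.\<close>
  have "\<exists>k. \<forall>z. length z = Suc n \<longrightarrow> suffix w z \<longrightarrow> \<beta> z = k"
  proof (cases "length w = Suc n")
    case True
    then have "z = w" if "length z = Suc n" "suffix w z" for z
      using that by (auto simp: suffix_def)
    then show ?thesis by (intro exI[of _ "\<beta> w"]) auto
  next
    case False
    have "\<beta> z = k" if "length z = Suc n" "suffix w z" for z
    proof -
      obtain a v where z: "z = a # v" "length v = n"
        using \<open>length z = Suc n\<close> by (auto simp: length_Suc_conv)
      then have "suffix w v" using that False by (auto simp: suffix_Cons)
      then have "sublist w v" by (rule suffix_imp_sublist)
      moreover have "\<alpha> v = k" using z \<open>suffix w v\<close> IH(4) by simp
      ultimately show ?thesis using z IH(1)[of v] by (simp add: \<beta>_def L_def)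
    qed
    then show ?thesis by (intro exI[of _ k]) auto
  qed
  then obtain k' where 3: "\<forall>z. length z = Suc n \<longrightarrow> suffix w z \<longrightarrow> \<beta> z = k'" ..
  show ?case
    using 1 2 3 ex(2) by (intro exI[of _ \<beta>] exI[of _ \<psi>] exI[of _ k']) simp
qed

text \<open>Two left extensions of a nonempty word take the same value since its extension graph is
  connected, so a function that follows the transitions of the words of length \<open>n\<close> is a function
  of the last letter.\<close>

lemma transition_last:
  assumes "\<And>z. z \<in> S \<Longrightarrow> c z \<in> D" and inj: "\<And>b. b \<in> A \<Longrightarrow> inj_on (\<rho> b) D"
    and "\<And>z b. z @ [b] \<in> S \<Longrightarrow> length z = Suc n \<Longrightarrow> c (tl (z @ [b])) = \<rho> b (c z)"
    and "z \<in> S" "z' \<in> S" "length z = Suc n" "length z' = Suc n" "last z = last z'"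
  shows "c z = c z'"
  using assms(1,3-)
proof (induction n arbitrary: c z z')
  case 0
  then have "z = z'" by (auto simp: length_Suc_conv)
  then show ?case by simp
next
  case (Suc n)
  have eq: "c (a # v) = c (a' # v)" if "length v = Suc n" "a # v \<in> S" "a' # v \<in> S" for a a' v
  proof -
    \<comment> \<open>At \<open>Inr b\<close> this is the value before the transition by
      \<open>b\<close>, recovered by injectivity of \<open>\<rho> b\<close>, so both ends of an edge
      agree.\<close>
    define \<kappa> where "\<kappa> x = (case x of Inl a \<Rightarrow> c (a # v) | Inr b \<Rightarrow> inv_into D (\<rho> b) (c (v @ [b])))" for x
    have edge: "\<kappa> (Inl e) = \<kappa> (Inr b)" if eb: "e # v @ [b] \<in> S" for e b
    proof -
      have "e # v \<in> S" using prefix_closed[of "e # v" "[b]"] eb by simp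
      moreover have "c (v @ [b]) = \<rho> b (c (e # v))"
        using Suc.prems(2)[of "e # v" b] eb \<open>length v = Suc n\<close> by simp
      moreover have "b \<in> A" using alphabet[OF eb] by simp
      ultimately show ?thesis using Suc.prems(1) inj by (simp add: \<kappa>_def)
    qed
    have "v \<in> S" "v \<noteq> []" using that tl_closed by auto
    moreover have "Inl a \<in> fst (E v)" "Inl a' \<in> fst (E v)"
      using that alphabet[OF that(2)] alphabet[OF that(3)]
      by (auto simp: extension_graph_def left_ext_def)
    ultimately have "connected_in (E v) (Inl a) (Inl a')" by (rule connected)
    then have "\<kappa> (Inl a) = \<kappa> (Inl a')"
      by (rule connected_in_invariant) (auto simp: edge_iff edge)
    then show ?thesis by (simp add: \<kappa>_def)
  qed
  \<comment> \<open>By \<open>eq\<close> the chosen left extension does not matter, so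
    \<open>c'\<close> follows the same transitions on words one letter shorter.\<close>
  define c' where "c' v = c ((SOME a. a # v \<in> S) # v)" for v
  have some: "(SOME a. a # v \<in> S) # v \<in> S" if "v \<in> S" for v
    using extend_left[OF that] by (rule someI_ex)
  have c': "c' v = c (a # v)" if "a # v \<in> S" "length v = Suc n" for a v
    unfolding c'_def using eq[OF that(2) some that(1)] that(1) tl_closed by blast
  obtain a v a' v' where z: "z = a # v" "z' = a' # v'" "length v = Suc n" "length v' = Suc n"
    using Suc.prems(5,6) by (auto simp: length_Suc_conv)
  have "v \<noteq> []" "v' \<noteq> []" using z by auto
  have "c' v = c' v'"
  proof (rule Suc.IH)
    show "c' u \<in> D" if "u \<in> S" for u using Suc.prems(1) some[OF that] by (simp add: c'_def)
    show "c' (tl (u @ [b])) = \<rho> b (c' u)" if u: "u @ [b] \<in> S" "length u = Suc n" for u b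
    proof -
      obtain d where d: "d # u @ [b] \<in> S" using extend_left[OF u(1)] by blast
      have du: "d # u \<in> S" using prefix_closed[of "d # u" "[b]"] d by simp
      obtain e x where e: "u = e # x" using u(2) by (cases u) auto
      have "c' (tl (u @ [b])) = c (u @ [b])"
        using c'[of e "x @ [b]"] u e by simp
      also have "\<dots> = \<rho> b (c (d # u))"
        using Suc.prems(2)[of "d # u" b] d u(2) by simp
      also have "c (d # u) = c' u" using c'[OF du u(2)] by simp
      finally show ?thesis .
    qed
    show "v \<in> S" "v' \<in> S" using Suc.prems(3,4) z tl_closed by auto
    show "length v = Suc n" "length v' = Suc n" using z by auto
    show "last v = last v'" using Suc.prems(7) z \<open>v \<noteq> []\<close> \<open>v' \<noteq> []\<close> by simp
  qed
  then show ?case using c' Suc.prems(3,4) z by simp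
qed

end

section \<open>Return words to a fixed word and their labellings\<close>

locale recurrent_specular = specular +
  fixes w :: "'a list"
  assumes recurrent: "recurrent A S" and w: "w \<in> S" and w_nonempty: "w \<noteq> []"
begin

abbreviation R :: "'a list set" where
  "R \<equiv> right_return_words S w"

lemma return_word_in: "y \<in> R \<Longrightarrow> w @ y \<in> S"
  by (simp add: right_return_words_def complete_return_words_def)

lemma return_word_nonempty: "y \<in> R \<Longrightarrow> y \<noteq> []"
  by (auto simp: right_return_words_def complete_return_words_def)

lemma return_word_suffix: "y \<in> R \<Longrightarrow> suffix w (w @ y)"
  by (simp add: right_return_words_def complete_return_words_def strict_suffix_def)

lemma return_word_not_internal: "y \<in> R \<Longrightarrow> w @ y = u @ w @ v \<Longrightarrow> u = [] \<or> v = []"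
  by (auto simp: right_return_words_def complete_return_words_def internal_factor_def)

lemma return_wordI:
  assumes "w @ y \<in> S" and "y \<noteq> []" and "suffix w (w @ y)"
    and "\<And>u v. w @ y = u @ w @ v \<Longrightarrow> u = [] \<or> v = []"
  shows "y \<in> R"
proof -
  have "w @ y \<noteq> w" using assms(2) by simp
  moreover have "strict_prefix w (w @ y)"
    using assms(2) by (auto intro: strict_prefixI)
  ultimately show ?thesis
    using assms unfolding right_return_words_def complete_return_words_def internal_factor_def
    by (auto simp: strict_suffix_def)
qed

text \<open>The shorter of the two complete return words is a suffix of the longer; if it were a
  proper one, its prefix \<open>w\<close> would be an internal factor there.\<close>

lemma return_word_unique:
  assumes "y \<in> R" "y' \<in> R" "suffix (w @ y) x" "suffix (w @ y') x"
  shows "y = y'"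
proof -
  have shorter: "y = y'" if "y \<in> R" "y' \<in> R" "suffix (w @ y) x" "suffix (w @ y') x"
    "length y \<le> length y'" for y y'
  proof -
    have "suffix (w @ y) (w @ y')"
      using that by - (rule suffix_length_suffix[of _ x], auto)
    then obtain u where u: "w @ y' = u @ w @ y" by (auto simp: suffix_def)
    have "u = [] \<or> y = []"
      by (rule return_word_not_internal[OF \<open>y' \<in> R\<close> u])
    then have "u = []"
      using return_word_nonempty[OF \<open>y \<in> R\<close>] by simp
    with u show ?thesis by simp
  qed
  show ?thesis
  proof (cases "length y \<le> length y'")
    case True
    then show ?thesis using shorter assms by simp
  next
    case False
    then show ?thesis using shorter[of y' y] assms by simp
  qed
qed

text \<open>The unit marks words that end with no complete return word, so that they do not
  contribute to the product of labels along a word.\<close>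

definition return_label :: "('k, 'm) monoid_scheme \<Rightarrow> ('a list \<Rightarrow> 'k) \<Rightarrow> 'a list \<Rightarrow> 'k" where
  "return_label K f x =
    (if \<exists>y\<in>R. suffix (w @ y) x then f (THE y. y \<in> R \<and> suffix (w @ y) x) else \<one>\<^bsub>K\<^esub>)"

lemma return_label_eq: "y \<in> R \<Longrightarrow> suffix (w @ y) x \<Longrightarrow> return_label K f x = f y"
proof -
  assume y: "y \<in> R" "suffix (w @ y) x"
  then have "(THE y. y \<in> R \<and> suffix (w @ y) x) = y"
    using return_word_unique by blast
  then show ?thesis using y by (auto simp: return_label_def)
qed

text \<open>A complete return word equal to \<open>a # v @ [b]\<close> would have the occurrence of
  \<open>w\<close> in \<open>v\<close> as an internal factor; any other that ends here fits in
  \<open>v @ [b]\<close>.\<close>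

lemma return_label_local:
  assumes "sublist w v"
  shows "return_label K f (a # v @ [b]) = return_label K f (v @ [b])"
proof -
  have "suffix (w @ y) (a # v @ [b]) \<longleftrightarrow> suffix (w @ y) (v @ [b])" if "y \<in> R" for y
  proof -
    have "w @ y \<noteq> a # v @ [b]"
    proof
      assume e: "w @ y = a # v @ [b]"
      obtain s t where "v = s @ w @ t" using assms by (auto simp: sublist_def)
      then have "w @ y = (a # s) @ w @ (t @ [b])" using e by simp
      then show False using return_word_not_internal[OF that] by blast
    qed
    then show ?thesis by (simp add: suffix_Cons)
  qed
  then have "(y \<in> R \<and> suffix (w @ y) (a # v @ [b])) = (y \<in> R \<and> suffix (w @ y) (v @ [b]))" for y
    by blast
  then show ?thesis unfolding return_label_def Bex_def by presburger
qed

text \<open>A window \<open>z\<close> of length \<open>n\<close> slides over \<open>y\<close>;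
  \<open>s\<close> is the part of the return word already read and \<open>t\<close> is padding on
  the left. Only the last letter completes a return word, so the earlier labels are trivial and the
  coboundary terms cancel. The length bound lets the last window and its new letter hold the
  complete return word.\<close>

lemma return_label_telescope:
  fixes K (structure)
  assumes "group K" and "\<And>z. \<alpha> z \<in> carrier K" "\<And>a. \<psi> a \<in> carrier K" "k \<in> carrier K"
    and cocycle: "\<And>z b. z @ [b] \<in> S \<Longrightarrow> length z = n \<Longrightarrow>
      return_label K f (z @ [b]) = \<alpha> z \<otimes> \<psi> b \<otimes> inv \<alpha> (tl (z @ [b]))"
    and const: "\<And>z. length z = n \<Longrightarrow> suffix w z \<Longrightarrow> \<alpha> z = k"
    and f: "\<And>y. f y \<in> carrier K"
    and "s @ y \<in> R" "y \<noteq> []" "t @ w @ s @ y \<in> S" "length (w @ s @ y) \<le> Suc n"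
    and "suffix z (t @ w @ s)" "length z = n"
  shows "f (s @ y) = \<alpha> z \<otimes> foldr (\<lambda>b p. \<psi> b \<otimes> p) y \<one> \<otimes> inv k"
  using assms(8-)
proof (induction y arbitrary: s z)
  case (Cons b y)
  interpret group K by fact
  have fold: "foldr (\<lambda>b p. \<psi> b \<otimes> p) y \<one> \<in> carrier K" for y
    using assms(3) by (induction y) auto
  obtain r where r: "t @ w @ s = r @ z" using Cons.prems(5) by (auto simp: suffix_def)
  have "(t @ w @ s) @ b # y \<in> S" using Cons.prems(3) by simp
  then have "z @ [b] \<in> S"
    unfolding r using factor_appendD[of r "z @ [b]" y] by simp
  note step = cocycle[OF this \<open>length z = n\<close>]
  have sfx: "suffix (z @ [b]) (t @ w @ s @ [b])"
    using arg_cong[OF r, of "\<lambda>x. x @ [b]"] by (simp add: suffix_def)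
  show ?case
  proof (cases "y = []")
    case True
    have "suffix (w @ s @ [b]) (t @ w @ s @ [b])" by (simp add: suffix_def)
    then have long: "suffix (w @ s @ [b]) (z @ [b])"
      using sfx Cons.prems(4,6) True
      by - (rule suffix_length_suffix[of _ "t @ w @ s @ [b]"], auto)
    have "return_label K f (z @ [b]) = f (s @ [b])"
      using long Cons.prems(1) True by (intro return_label_eq) auto
    \<comment> \<open>The word \<open>z @ [b]\<close> ends with \<open>w\<close>, and the bound
      gives \<open>w\<close> at most \<open>n\<close> letters, so dropping the first letter keeps
      this suffix.\<close>
    moreover have "\<alpha> (tl (z @ [b])) = k"
    proof (rule const)
      show "length (tl (z @ [b])) = n" using Cons.prems(6) by simp
      have "suffix w (z @ [b])"
        by (rule suffix_order.trans[OF _ long]) (use return_word_suffix[OF Cons.prems(1)] True in simp)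
      moreover have "w \<noteq> z @ [b]" using Cons.prems(4,6) by (auto dest: arg_cong[of _ _ length])
      ultimately show "suffix w (tl (z @ [b]))"
        by (cases "z @ [b]") (auto simp: suffix_Cons)
    qed
    ultimately show ?thesis using step True assms(2-4) by (simp add: m_assoc)
  next
    case False
    \<comment> \<open>A return word completed here would make \<open>w\<close> an internal factor of
      \<open>w @ s @ b # y\<close>, since \<open>y\<close> is nonempty.\<close>
    have "return_label K f (z @ [b]) = \<one>"
    proof -
      have False if "y' \<in> R" "suffix (w @ y') (z @ [b])" for y'
      proof -
        have "suffix w (t @ w @ s @ [b])"
          using return_word_suffix[OF that(1)] that(2) sfx by (meson suffix_order.trans)
        moreover have "suffix (w @ s @ [b]) (t @ w @ s @ [b])" by (simp add: suffix_def)
        ultimately have "suffix w (w @ s @ [b])"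
          by (rule suffix_length_suffix) simp
        then obtain u where u: "w @ s @ [b] = u @ w" by (auto simp: suffix_def)
        have "u \<noteq> []"
        proof
          assume "u = []"
          then show False using arg_cong[OF u, of length] by simp
        qed
        moreover have "w @ s @ b # y = u @ w @ y"
          using arg_cong[OF u, of "\<lambda>x. x @ y"] by simp
        ultimately show False
          using return_word_not_internal[OF Cons.prems(1), of u y] False by simp
      qed
      then show ?thesis by (auto simp: return_label_def)
    qed
    then have "\<alpha> z \<otimes> \<psi> b = \<alpha> (tl (z @ [b]))"
      using step assms(2,3) by (metis inv_solve_right l_one m_closed one_closed)
    moreover have "suffix (tl (z @ [b])) (t @ w @ s @ [b])"
      by (rule suffix_order.trans[OF suffix_tl sfx])
    then have "f ((s @ [b]) @ y) = \<alpha> (tl (z @ [b])) \<otimes> foldr (\<lambda>b p. \<psi> b \<otimes> p) y \<one> \<otimes> inv k"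
      using Cons.IH[of "s @ [b]" "tl (z @ [b])"] Cons.prems False by simp
    ultimately show ?thesis
      using assms(2-4) fold[of y] by (simp flip: m_assoc)
  qed
qed simp

text \<open>The first and the last window both end with \<open>w\<close>, so both coboundary terms
  are the constant \<open>k\<close>. The length bound is there because finiteness of
  \<open>R\<close> is derived from this lemma.\<close>

lemma return_words_cocycle:
  fixes K (structure) and f :: "'a list \<Rightarrow> 'k"
  assumes "group K" and f: "\<And>y. f y \<in> carrier K"
  shows "\<exists>\<psi> k. (\<forall>a. \<psi> a \<in> carrier K) \<and> k \<in> carrier K \<and>
    (\<forall>y\<in>R. length (w @ y) \<le> Suc n \<longrightarrow> f y = k \<otimes> foldr (\<lambda>b p. \<psi> b \<otimes> p) y \<one> \<otimes> inv k)"
proof -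
  interpret group K by fact
  define h where "h = return_label K f"
  have hc: "h x \<in> carrier K" for x
    using f by (simp add: h_def return_label_def)
  have hl: "h (a # v @ [b]) = h (v @ [b])" if "sublist w v" for a v b
    unfolding h_def using that by (rule return_label_local)
  from cocycle_descent[OF \<open>group K\<close>, of h w h n, OF hc hl hc hl] obtain \<alpha> \<psi> k
    where c: "\<forall>z. \<alpha> z \<in> carrier K" "\<forall>a. \<psi> a \<in> carrier K"
    "\<forall>z b. z @ [b] \<in> S \<longrightarrow> length z = n \<longrightarrow> h (z @ [b]) = \<alpha> z \<otimes> \<psi> b \<otimes> inv \<alpha> (tl (z @ [b]))"
    "\<forall>z. length z = n \<longrightarrow> suffix w z \<longrightarrow> \<alpha> z = k"
    by blast
  have main: "f y = k \<otimes> foldr (\<lambda>b p. \<psi> b \<otimes> p) y \<one> \<otimes> inv k \<and> k \<in> carrier K"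
    if y: "y \<in> R" and len: "length (w @ y) \<le> Suc n" for y
  proof -
    obtain t where t: "length t = n" "t @ w @ y \<in> S"
      using extend_left_length[OF return_word_in[OF y]] by blast
    define z where "z = drop (length w) (t @ w)"
    have z: "suffix z (t @ w)" "length z = n"
      using t(1) unfolding z_def by (simp_all only: suffix_drop length_drop length_append diff_add_inverse2)
    have "length w \<le> n"
      using len return_word_nonempty[OF y] by (cases y) auto
    then have "suffix w z"
      using z by - (rule suffix_length_suffix[of _ "t @ w"], auto simp: suffix_def)
    then have "\<alpha> z = k" using c(4) z by blast
    moreover from this have "k \<in> carrier K" using c(1) by blast
    moreover from this have "f ([] @ y) = \<alpha> z \<otimes> foldr (\<lambda>b p. \<psi> b \<otimes> p) y \<one> \<otimes> inv k"
      using c z t y len return_word_nonempty[OF y] f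
      by (intro return_label_telescope[OF \<open>group K\<close>, of \<alpha> \<psi> k n f "[]" y t z]) (auto simp: h_def)
    ultimately show ?thesis by simp
  qed
  \<comment> \<open>So far \<open>k\<close> lies in the carrier only if some return word meets the
    bound; if none does, the claim is vacuous and the unit serves.\<close>
  define k' where "k' = (if k \<in> carrier K then k else \<one>)"
  have "\<forall>y\<in>R. length (w @ y) \<le> Suc n \<longrightarrow> f y = k' \<otimes> foldr (\<lambda>b p. \<psi> b \<otimes> p) y \<one> \<otimes> inv k'"
    using main by (simp add: k'_def)
  moreover have "k' \<in> carrier K" by (simp add: k'_def)
  ultimately show ?thesis using c(2) by blast
qed

end

section \<open>The group of the involution\<close>

context specular
begin

abbreviation G :: "'a gword set monoid" where
  "G \<equiv> specular_group A \<theta>"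

abbreviation el :: "'a list \<Rightarrow> 'a gword set" where
  "el \<equiv> word_elem A \<theta>"

lemma group_G: "group G"
  unfolding specular_group_def by (rule group_presented_group)

lemma gwords_letters: "u \<in> lists A \<Longrightarrow> map (\<lambda>a. (a, True)) u \<in> gwords A"
  by auto

lemma el_closed: "u \<in> lists A \<Longrightarrow> el u \<in> carrier G"
  unfolding specular_group_def word_elem_def presented_group_def
  using gwords_letters by simp

lemma el_append: "u \<in> lists A \<Longrightarrow> v \<in> lists A \<Longrightarrow> el (u @ v) = el u \<otimes>\<^bsub>G\<^esub> el v"
  unfolding specular_group_def word_elem_def map_append
  by (rule presented_group_mult[symmetric]; rule gwords_letters)

lemma el_Nil: "el [] = \<one>\<^bsub>G\<^esub>"
  by (simp add: specular_group_def word_elem_def presented_group_def)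

lemma el_cancel: "a \<in> A \<Longrightarrow> el [a, \<theta> a] = \<one>\<^bsub>G\<^esub>"
  using pres_eq.relator[of "[]" A "[]" "[(a, True), (\<theta> a, True)]" "specular_relators A \<theta>"]
    pres_class_eq_iff[of "[(a, True), (\<theta> a, True)]" A "specular_relators A \<theta>" "[]"] theta_closed
  by (auto simp: specular_group_def word_elem_def presented_group_def specular_relators_def)

lemma el_mult_theta:
  assumes "a \<in> A"
  shows "el [a] \<otimes>\<^bsub>G\<^esub> el [\<theta> a] = \<one>\<^bsub>G\<^esub>"
  using el_append[of "[a]" "[\<theta> a]"] el_cancel[OF assms] assms by (simp add: theta_closed)

lemma inv_el:
  assumes "u \<in> lists A"
  shows "inv\<^bsub>G\<^esub> el u = el (word_inverse \<theta> u)"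
  using assms
proof (induction u rule: list.induct)
  case Nil
  then show ?case using monoid.inv_one[OF group.is_monoid[OF group_G]] by (simp add: el_Nil word_inverse_def)
next
  case (Cons a u)
  interpret group G by (rule group_G)
  have "a \<in> A" "u \<in> lists A" using Cons.prems by simp_all
  then have a: "a \<in> A" "u \<in> lists A" "word_inverse \<theta> u \<in> lists A" "[\<theta> a] \<in> lists A" "[a] \<in> lists A"
    by (auto simp: word_inverse_def theta_closed)
  have "el (a # u) = el [a] \<otimes>\<^bsub>G\<^esub> el u"
    using el_append[of "[a]" u] a by simp
  moreover have "inv\<^bsub>G\<^esub> el [a] = el [\<theta> a]"
    using el_mult_theta[of "\<theta> a"] a theta_theta by (intro inv_equality el_closed) auto
  moreover have "el (word_inverse \<theta> (a # u)) = el (word_inverse \<theta> u) \<otimes>\<^bsub>G\<^esub> el [\<theta> a]"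
    using el_append[of "word_inverse \<theta> u" "[\<theta> a]"] a by (simp add: word_inverse_def)
  ultimately show ?case
    using Cons.IH a el_closed by (simp add: inv_mult_group)
qed

lemma even_word_simps:
  "even_word A S []"
  "even_word A S (a # u) = (even_letter A S a = even_word A S u)"
  "even_word A S (u @ v) = (even_word A S u = even_word A S v)"
  by (auto simp: even_word_def)

end

section \<open>Parity and the two trees\<close>

context recurrent_specular
begin

text \<open>Truth values name the two trees of \<open>E []\<close>; \<open>True\<close> is the state
  in which reading continues after \<open>w\<close>.\<close>

definition state :: "'a + 'a \<Rightarrow> bool" where
  "state v = connected_in (E []) (Inl (last w)) v"

lemma vertex: "Inl a \<in> fst (E []) \<longleftrightarrow> a \<in> A" "Inr a \<in> fst (E []) \<longleftrightarrow> a \<in> A"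
  using letter by (auto simp: extension_graph_def left_ext_def right_ext_def)

lemma last_w: "last w \<in> A"
  using alphabet[OF w] w_nonempty by auto

lemma state_root: "state (Inl (last w))"
  by (simp add: state_def connected_in_refl)

text \<open>As there are only two trees, not being connected to \<open>Inl (last w)\<close> also
  determines the tree.\<close>

lemma connected_iff_state:
  assumes "x \<in> fst (E [])" "y \<in> fst (E [])"
  shows "connected_in (E []) x y \<longleftrightarrow> state x = state y"
proof -
  have "disjoint_union_of_trees 2 (E [])"
    using specular by (simp add: specular_set_def tree_set_def)
  then have "finite (components (E []))" "card (components (E [])) = 2"
    unfolding disjoint_union_of_trees_def by auto
  moreover have "Inl (last w) \<in> fst (E [])" using last_w vertex by blast
  ultimately show ?thesis
    using assms two_components[of "E []" "Inl (last w)" x y] unfolding state_def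
    by (meson connected_in_sym connected_in_trans)
qed

lemma state_edge: "[a, b] \<in> S \<Longrightarrow> state (Inl a) = state (Inr b)"
proof -
  assume ab: "[a, b] \<in> S"
  then have "{Inl a, Inr b} \<in> snd (E [])" by (auto simp: edge_iff)
  then have "connected_in (E []) (Inl a) (Inr b)" by (rule connected_in_edge)
  then show ?thesis
    using alphabet[OF ab] by (simp add: connected_iff_state vertex)
qed

lemma state_inverse: "a \<in> A \<Longrightarrow> state (Inr (\<theta> a)) = (\<not> state (Inl a))"
  using inverse_not_connected[of a] by (simp add: connected_iff_state vertex theta_closed)

lemma state_inverse': "a \<in> A \<Longrightarrow> state (Inl (\<theta> a)) = (\<not> state (Inr a))"
  using state_inverse[of "\<theta> a"] by (simp add: theta_theta theta_closed)

lemma even_letter_iff_state: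
  assumes "a \<in> A"
  shows "even_letter A S a \<longleftrightarrow> state (Inl a) = state (Inr a)"
proof -
  have "even_letter A S a \<longleftrightarrow> connected_in (E []) (Inl a) (Inr a)"
  proof
    assume "even_letter A S a"
    then show "connected_in (E []) (Inl a) (Inr a)"
      unfolding even_letter_def components_def by (auto intro: connected_in_trans connected_in_sym)
  next
    assume "connected_in (E []) (Inl a) (Inr a)"
    then show "even_letter A S a"
      using assms vertex unfolding even_letter_def components_def
      by (auto intro!: bexI[of _ "Inl a"] simp: connected_in_refl)
  qed
  then show ?thesis using assms connected_iff_state vertex by simp
qed

lemma even_letter_theta: "a \<in> A \<Longrightarrow> even_letter A S (\<theta> a) = even_letter A S a"
  by (auto simp: even_letter_iff_state state_inverse state_inverse' theta_closed)

lemma even_word_inverse: "u \<in> lists A \<Longrightarrow> even_word A S (word_inverse \<theta> u) = even_word A S u"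
  by (induction u) (auto simp: word_inverse_def even_word_simps even_letter_theta)

lemma subgroup_even: "subgroup (carrier (even_subgroup A \<theta> S)) G"
proof -
  interpret group G by (rule group_G)
  let ?U = "{u \<in> lists A. even_word A S u}"
  have carr: "carrier (even_subgroup A \<theta> S) = el ` ?U" by (simp add: even_subgroup_def)
  show ?thesis
    unfolding carr
  proof (rule subgroupI)
    show "el ` ?U \<subseteq> carrier G" using el_closed by blast
    show "el ` ?U \<noteq> {}" using even_word_simps(1) by blast
    show "inv\<^bsub>G\<^esub> x \<in> el ` ?U" if x: "x \<in> el ` ?U" for x
    proof -
      obtain u where u: "x = el u" "u \<in> lists A" "even_word A S u" using x by blast
      moreover have "word_inverse \<theta> u \<in> lists A"
        using u(2) theta_closed by (auto simp: word_inverse_def)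
      ultimately show ?thesis using inv_el even_word_inverse by blast
    qed
    show "x \<otimes>\<^bsub>G\<^esub> y \<in> el ` ?U" if xy: "x \<in> el ` ?U" "y \<in> el ` ?U" for x y
    proof -
      obtain u v where uv: "x = el u" "u \<in> lists A" "even_word A S u"
        "y = el v" "v \<in> lists A" "even_word A S v" using xy by blast
      then have "x \<otimes>\<^bsub>G\<^esub> y = el (u @ v)" "u @ v \<in> ?U"
        using el_append[of u v] by (simp_all add: even_word_simps)
      then show ?thesis by blast
    qed
  qed
qed

text \<open>A letter \<open>a\<close> read in state \<open>i\<close> leads to the state \<open>i = even_letter A S a\<close>.  In a word of \<open>S\<close>,
  it is read in the state of its right vertex and leads to that of its left vertex; the letter
  \<open>\<theta> a\<close> then is only read in the other state, so that \<open>\<psi>\<close> can be chosen freely.\<close>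

primrec val :: "('k, 'm) monoid_scheme \<Rightarrow> ('a \<Rightarrow> 'k) \<Rightarrow> bool \<Rightarrow> 'a list \<Rightarrow> 'k" where
  "val K \<psi> i [] = \<one>\<^bsub>K\<^esub>"
| "val K \<psi> i (a # u) = (if i = state (Inr a) then \<psi> a else inv\<^bsub>K\<^esub> \<psi> (\<theta> a)) \<otimes>\<^bsub>K\<^esub>
    val K \<psi> (i = even_letter A S a) u"

context
  fixes K (structure) and \<psi> :: "'a \<Rightarrow> 'k"
  assumes K: "group K" and \<psi>: "\<And>a. \<psi> a \<in> carrier K"
begin

interpretation group K by (rule K)

lemma val_closed: "val K \<psi> i u \<in> carrier K"
  by (induction u arbitrary: i) (auto simp: \<psi>)

lemma val_append: "val K \<psi> i (u @ v) = val K \<psi> i u \<otimes> val K \<psi> (i = even_word A S u) v"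
proof (induction u arbitrary: i)
  case Nil
  then show ?case by (simp add: val_closed even_word_simps)
next
  case (Cons a u)
  have "(i = (even_letter A S a = even_word A S u)) = ((i = even_letter A S a) = even_word A S u)"
    by auto
  then show ?case using Cons \<psi> by (simp add: m_assoc val_closed even_word_simps)
qed

text \<open>Exactly one of the two letters is read in the state of its own right vertex; the other
  contributes the inverse of its value.\<close>

lemma val_cancel:
  assumes "a \<in> A"
  shows "val K \<psi> i [a, \<theta> a] = \<one>"
proof (cases "i = state (Inr a)")
  case True
  have "(i = even_letter A S a) \<noteq> state (Inr (\<theta> a))"
    using True assms by (auto simp: even_letter_iff_state state_inverse)
  then show ?thesis using True assms \<psi> by (simp add: theta_theta)
next
  case False
  have "(i = even_letter A S a) = state (Inr (\<theta> a))"
    using False assms by (auto simp: even_letter_iff_state state_inverse)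
  then show ?thesis using False assms \<psi> by simp
qed

lemma val_cancel_middle:
  assumes "a \<in> A"
  shows "val K \<psi> i (u @ [a, \<theta> a] @ v) = val K \<psi> i (u @ v)"
proof -
  have "even_word A S [a, \<theta> a]" using assms by (simp add: even_word_simps even_letter_theta)
  then show ?thesis
    unfolding val_append[of _ "[a, \<theta> a]"] val_append[of _ u] using assms
    by (simp add: val_cancel val_closed del: val.simps)
qed

text \<open>A formal inverse of \<open>a\<close> becomes \<open>\<theta> a\<close>, so that
  \<open>val\<close> can be evaluated on group words.\<close>

definition letters :: "'a gword \<Rightarrow> 'a list" where
  "letters u = map (\<lambda>(a, e). if e then a else \<theta> a) u"

lemma val_pres_eq:
  "pres_eq A (specular_relators A \<theta>) u v \<Longrightarrow> val K \<psi> i (letters u) = val K \<psi> i (letters v)"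
proof (induction rule: pres_eq.induct)
  case (cancel u v x e)
  then show ?case
    using val_cancel_middle[of x i "letters u" "letters v"]
      val_cancel_middle[of "\<theta> x" i "letters u" "letters v"] theta_closed theta_theta
    by (cases e) (simp_all add: letters_def del: val.simps)
next
  case (relator u v r)
  then obtain a where "a \<in> A" "r = [(a, True), (\<theta> a, True)]"
    by (auto simp: specular_relators_def)
  then show ?case
    using val_cancel_middle[of a i "letters u" "letters v"]
    by (simp add: letters_def del: val.simps)
qed simp_all

text \<open>\<open>val\<close> respects the relations, hence is a function on \<open>G\<close>. An
  even word leads from state \<open>True\<close> back to \<open>True\<close>, which makes it
  multiplicative on the even subgroup.\<close>

lemma even_hom:
  "\<exists>F \<in> hom (even_subgroup A \<theta> S) K. \<forall>u\<in>lists A. F (el u) = val K \<psi> True u"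
proof -
  define F where "F P = val K \<psi> True (letters (SOME v. v \<in> P))" for P
  have F: "F (el u) = val K \<psi> True u" if "u \<in> lists A" for u
  proof -
    let ?u = "map (\<lambda>a. (a, True)) u"
    have "?u \<in> el u"
      using gwords_letters[OF that] by (auto simp: word_elem_def pres_class_def intro: pres_eq.refl)
    then have "(SOME v. v \<in> el u) \<in> el u" by (rule someI)
    then have "pres_eq A (specular_relators A \<theta>) ?u (SOME v. v \<in> el u)"
      by (simp add: word_elem_def pres_class_def)
    moreover have "letters ?u = u" by (simp add: letters_def comp_def)
    ultimately show ?thesis using val_pres_eq[of ?u _ True] by (simp add: F_def)
  qed
  have "F \<in> hom (even_subgroup A \<theta> S) K"
  proof (rule homI)
    fix P assume "P \<in> carrier (even_subgroup A \<theta> S)"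
    then show "F P \<in> carrier K" by (simp add: F_def val_closed)
  next
    fix P Q assume "P \<in> carrier (even_subgroup A \<theta> S)" "Q \<in> carrier (even_subgroup A \<theta> S)"
    then obtain u v where uv: "P = el u" "u \<in> lists A" "even_word A S u"
      "Q = el v" "v \<in> lists A" "even_word A S v"
      by (auto simp: even_subgroup_def)
    have "P \<otimes>\<^bsub>even_subgroup A \<theta> S\<^esub> Q = el (u @ v)"
      using uv el_append by (simp add: even_subgroup_def)
    moreover have "u @ v \<in> lists A" using uv by simp
    ultimately show "F (P \<otimes>\<^bsub>even_subgroup A \<theta> S\<^esub> Q) = F P \<otimes> F Q"
      using uv by (simp only: F val_append) simp
  qed
  then show ?thesis using F by blast
qed

text \<open>Consecutive letters of a word of \<open>S\<close> form an edge of \<open>E []\<close>,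
  so each letter is read in the state of its own right vertex and contributes \<open>\<psi>\<close>
  without inverses.\<close>

lemma val_factor:
  assumes "z @ y \<in> S" "z \<noteq> []"
  shows "val K \<psi> (state (Inl (last z))) y = foldr (\<lambda>b p. \<psi> b \<otimes> p) y \<one> \<and>
    state (Inl (last (z @ y))) = (state (Inl (last z)) = even_word A S y)"
  using assms
proof (induction y arbitrary: z)
  case (Cons b y)
  have "butlast z @ [last z, b] @ y \<in> S"
    using Cons.prems by (cases z rule: rev_cases) simp_all
  then have e: "[last z, b] \<in> S" by (rule factor_appendD)
  then have "b \<in> A" using alphabet by fastforce
  have st: "state (Inl (last z)) = state (Inr b)" using e by (rule state_edge)
  have "state (Inl b) = (state (Inr b) = even_letter A S b)"
    using even_letter_iff_state[OF \<open>b \<in> A\<close>] by auto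
  then show ?case
    using Cons.IH[of "z @ [b]"] Cons.prems(1) st by (auto simp: even_word_simps)
qed (simp add: even_word_simps)

end

section \<open>Return words in the even subgroup\<close>

lemma last_return_word: "y \<in> R \<Longrightarrow> last (w @ y) = last w"
proof -
  assume "y \<in> R"
  then obtain u where "w @ y = u @ w" using return_word_suffix by (auto simp: suffix_def)
  then show ?thesis using w_nonempty by simp
qed

lemma return_word_letters: "y \<in> R \<Longrightarrow> y \<in> lists A"
  using alphabet[OF return_word_in] by (auto simp: lists_eq_set)

text \<open>The words \<open>w\<close> and \<open>w @ y\<close> have the same last letter, hence
  lead to the same state; an odd \<open>y\<close> would change it.\<close>

lemma return_word_even: "y \<in> R \<Longrightarrow> even_word A S y"
  using val_factor[OF group_bool_group, of "\<lambda>_. False" w y] return_word_in w_nonempty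
    last_return_word state_root by (auto simp: bool_group_def)

text \<open>The homomorphism given by \<open>even_hom\<close> sends \<open>el y\<close> to the
  product of the letter values; conjugation by \<open>k\<close> turns this into
  \<open>f y\<close>.\<close>

lemma return_words_hom:
  fixes K (structure) and f :: "'a list \<Rightarrow> 'k"
  assumes K: "group K" and f: "\<And>y. f y \<in> carrier K"
  shows "\<exists>F \<in> hom (even_subgroup A \<theta> S) K. \<forall>y\<in>R. length (w @ y) \<le> Suc n \<longrightarrow> F (el y) = f y"
proof -
  interpret group K by fact
  obtain \<psi> k where \<psi>: "\<And>a. \<psi> a \<in> carrier K" and k: "k \<in> carrier K"
    and fk: "\<And>y. y \<in> R \<Longrightarrow> length (w @ y) \<le> Suc n \<Longrightarrow>
      f y = k \<otimes> foldr (\<lambda>b p. \<psi> b \<otimes> p) y \<one> \<otimes> inv k"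
    using return_words_cocycle[OF K, of f n] f by blast
  obtain F where F: "F \<in> hom (even_subgroup A \<theta> S) K" "\<And>u. u \<in> lists A \<Longrightarrow> F (el u) = val K \<psi> True u"
    using even_hom[OF K, of \<psi>] \<psi> by blast
  have "(\<lambda>P. k \<otimes> F P \<otimes> inv k) \<in> hom (even_subgroup A \<theta> S) K"
  proof (rule homI)
    show "k \<otimes> F P \<otimes> inv k \<in> carrier K" if "P \<in> carrier (even_subgroup A \<theta> S)" for P
      using k hom_in_carrier[OF F(1) that] by simp
    show "k \<otimes> F (P \<otimes>\<^bsub>even_subgroup A \<theta> S\<^esub> Q) \<otimes> inv k = k \<otimes> F P \<otimes> inv k \<otimes> (k \<otimes> F Q \<otimes> inv k)"
      if PQ: "P \<in> carrier (even_subgroup A \<theta> S)" "Q \<in> carrier (even_subgroup A \<theta> S)" for P Q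
    proof -
      have c: "F P \<in> carrier K" "F Q \<in> carrier K" using hom_in_carrier[OF F(1)] PQ by auto
      then have "inv k \<otimes> (k \<otimes> (F Q \<otimes> inv k)) = F Q \<otimes> inv k"
        using k by (simp flip: m_assoc)
      then show ?thesis using hom_mult[OF F(1)] PQ k c by (simp add: m_assoc)
    qed
  qed
  moreover have "k \<otimes> F (el y) \<otimes> inv k = f y" if "y \<in> R" "length (w @ y) \<le> Suc n" for y
    using fk[OF that] F(2)[OF return_word_letters] that(1)
      val_factor[OF K, of \<psi> w y] \<psi> return_word_in w_nonempty state_root by auto
  ultimately show ?thesis by (intro bexI[of _ "\<lambda>P. k \<otimes> F P \<otimes> inv k"]) simp_all
qed

text \<open>The 0-1 labellings of a finite set of return words come from 0-1 labellings of the alphabet.\<close>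

lemma finite_return_words: "finite R"
proof (rule ccontr)
  assume "infinite R"
  then obtain B where B: "finite B" "card B = Suc (card A)" "B \<subseteq> R"
    using infinite_arbitrarily_large by metis
  define n where "n = Max ((\<lambda>y. length (w @ y)) ` B)"
  have n: "length (w @ y) \<le> Suc n" if "y \<in> B" for y
  proof -
    have "length (w @ y) \<le> n"
      unfolding n_def using B(1) that by (intro Max_ge) auto
    then show ?thesis by simp
  qed
  \<comment> \<open>The group of order 2 is abelian, so the conjugation disappears.\<close>
  have inv_bool: "k \<otimes>\<^bsub>bool_group\<^esub> p \<otimes>\<^bsub>bool_group\<^esub> inv\<^bsub>bool_group\<^esub> k = p" for k p
    using group.r_inv[OF group_bool_group, of k] by (auto simp: bool_group_def)
  have "\<exists>\<psi>. \<forall>y\<in>B. (y \<in> X) = foldr (\<lambda>b p. \<psi> b \<noteq> p) y False" for X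
  proof -
    obtain \<psi> k where "\<forall>y\<in>R. length (w @ y) \<le> Suc n \<longrightarrow> (y \<in> X) =
        k \<otimes>\<^bsub>bool_group\<^esub> foldr (\<lambda>b p. \<psi> b \<otimes>\<^bsub>bool_group\<^esub> p) y \<one>\<^bsub>bool_group\<^esub>
          \<otimes>\<^bsub>bool_group\<^esub> inv\<^bsub>bool_group\<^esub> k"
      using return_words_cocycle[OF group_bool_group, of "\<lambda>y. y \<in> X" n]
      by (auto simp: bool_group_def)
    then have "\<forall>y\<in>B. (y \<in> X) = foldr (\<lambda>b p. \<psi> b \<otimes>\<^bsub>bool_group\<^esub> p) y \<one>\<^bsub>bool_group\<^esub>"
      using n B(3) unfolding inv_bool by blast
    then show ?thesis by (intro exI[of _ \<psi>]) (simp add: bool_group_def)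
  qed
  then obtain \<Psi> where \<Psi>: "\<And>X y. y \<in> B \<Longrightarrow> (y \<in> X) = foldr (\<lambda>b p. \<Psi> X b \<noteq> p) y False"
    by metis
  \<comment> \<open>The letters of \<open>A\<close> on which \<open>\<Psi> X\<close> holds determine
    \<open>X\<close>, so \<open>B\<close> has no more subsets than \<open>A\<close>.\<close>
  have "inj_on (\<lambda>X. {a \<in> A. \<Psi> X a}) (Pow B)"
  proof (rule inj_onI)
    fix X Y assume XY: "X \<in> Pow B" "Y \<in> Pow B" and e: "{a \<in> A. \<Psi> X a} = {a \<in> A. \<Psi> Y a}"
    have "(y \<in> X) = (y \<in> Y)" if "y \<in> B" for y
    proof -
      have "\<Psi> X b = \<Psi> Y b" if "b \<in> set y" for b
        using that e return_word_letters \<open>y \<in> B\<close> B(3) by fastforce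
      then have "foldr (\<lambda>b p. \<Psi> X b \<noteq> p) y False = foldr (\<lambda>b p. \<Psi> Y b \<noteq> p) y False"
        by (intro foldr_cong) auto
      then show ?thesis using \<Psi>[OF that] by blast
    qed
    then show "X = Y" using XY by blast
  qed
  then have "card (Pow B) \<le> card (Pow A)"
    using finite_alphabet by (intro card_inj_on_le) auto
  then show False using B finite_alphabet by (simp add: card_Pow)
qed

end

section \<open>Generation by return words\<close>

context recurrent_specular
begin

text \<open>Recurrence places \<open>z\<close> between two occurrences of \<open>w\<close>. The last
  occurrence that starts before \<open>z\<close> and the next one delimit a complete return word. It
  is no longer than \<open>z\<close>, so its final \<open>w\<close> ends within \<open>z\<close>,
  and starts there by the choice of the first.\<close>

lemma long_word_contains_w:
  assumes M: "\<And>y. y \<in> R \<Longrightarrow> length (w @ y) \<le> M" and z: "z \<in> S" "M \<le> length z"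
  shows "sublist w z"
proof -
  obtain v where v: "w @ v @ z \<in> S"
    using recurrent w z(1) unfolding recurrent_def by blast
  then obtain v' where "(w @ v @ z) @ v' @ w \<in> S"
    using recurrent w unfolding recurrent_def by blast
  then have X: "(w @ v) @ z @ v' @ w \<in> S" by simp
  define X where "X = (w @ v) @ z @ v' @ w"
  \<comment> \<open>\<open>s\<close> is where \<open>z\<close> starts in \<open>X\<close>,
    \<open>p\<close> the last start of \<open>w\<close> before \<open>s\<close>, and
    \<open>q\<close> the next start of \<open>w\<close> after \<open>p\<close>.\<close>
  define s where "s = length (w @ v)"
  define occ where "occ p \<longleftrightarrow> (\<exists>u t. X = u @ w @ t \<and> length u = p)" for p
  let ?P = "{p. occ p \<and> p < s}"
  define p where "p = Max ?P"
  have fin: "finite ?P" by (rule finite_subset[of _ "{..<s}"]) auto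
  have "occ 0"
    unfolding occ_def X_def by (intro exI[of _ "[]"] exI[of _ "v @ z @ v' @ w"]) simp
  then have "0 \<in> ?P" using w_nonempty by (simp add: s_def)
  then have "p \<in> ?P" unfolding p_def using Max_in[OF fin] by blast
  then obtain u t where u: "X = u @ w @ t" "length u = p" and ps: "p < s"
    unfolding occ_def by blast
  define q where "q = (LEAST q. occ q \<and> p < q)"
  have "occ (length (w @ v @ z @ v'))"
    unfolding occ_def X_def by (intro exI[of _ "w @ v @ z @ v'"] exI[of _ "[]"]) simp
  moreover have "p < length (w @ v @ z @ v')" using ps by (simp add: s_def)
  ultimately have q: "occ q \<and> p < q" unfolding q_def by (intro LeastI[of "\<lambda>q. occ q \<and> p < q"]) simp
  then obtain u' t' where u': "X = u' @ w @ t'" "length u' = q" unfolding occ_def by blast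
  have "prefix u X" "prefix u' X" using u(1) by simp (simp add: u'(1))
  then have "prefix u u'"
    using u(2) u'(2) q by - (rule prefix_length_prefix, auto)
  then obtain d where d: "u' = u @ d" by (auto simp: prefix_def)
  have "d \<noteq> []" using d u u' q by auto
  have "w @ t = (d @ w) @ t'" using u(1) u'(1) d by simp
  then have "prefix w ((d @ w) @ t')" by (metis prefixI)
  then have "prefix w (d @ w)"
    by (rule prefix_length_prefix) auto
  then obtain y where y: "d @ w = w @ y" by (auto simp: prefix_def)
  have "y \<in> R"
  proof (rule return_wordI)
    have "u @ (d @ w) @ t' \<in> S" using X u'(1) d by (simp add: X_def)
    then show "w @ y \<in> S" unfolding y by (rule factor_appendD)
    show "y \<noteq> []" using arg_cong[OF y, of length] \<open>d \<noteq> []\<close> by auto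
    show "suffix w (w @ y)" unfolding y[symmetric] by (simp add: suffix_def)
    show "a = [] \<or> b = []" if ab: "w @ y = a @ w @ b" for a b
    proof (rule ccontr)
      assume "\<not> (a = [] \<or> b = [])"
      have dw: "d @ w = a @ w @ b" using y ab by simp
      have "X = (u @ a) @ w @ (b @ t')"
        using u'(1) d arg_cong[OF dw, of "\<lambda>x. u @ x @ t'"] by simp
      then have "occ (p + length a)" unfolding occ_def using u(2) by (metis length_append)
      moreover have "p < p + length a" using \<open>\<not> (a = [] \<or> b = [])\<close> by simp
      ultimately have "q \<le> p + length a" unfolding q_def by (intro Least_le) simp
      moreover have "q = p + length d" using d u(2) u'(2) by simp
      moreover have "length d = length a + length b" using arg_cong[OF dw, of length] by simp
      ultimately show False using \<open>\<not> (a = [] \<or> b = [])\<close> by simp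
    qed
  qed
  then have "length (d @ w) \<le> length z" unfolding y using M z(2) by (meson le_trans)
  then have end_in: "q + length w \<le> s + length z" using d u(2) u'(2) ps by simp
  have "s \<le> q"
  proof (rule ccontr)
    assume "\<not> s \<le> q"
    then have "q \<le> p" unfolding p_def using q by (intro Max_ge[OF fin]) simp
    then show False using q by simp
  qed
  have "prefix (w @ v) X" unfolding X_def by simp
  moreover have "prefix u' X" unfolding u'(1) by simp
  ultimately have "prefix (w @ v) u'"
    by (rule prefix_length_prefix) (use \<open>s \<le> q\<close> u'(2) in \<open>simp add: s_def\<close>)
  then obtain r where r: "u' = (w @ v) @ r" by (auto simp: prefix_def)
  then have "z @ v' @ w = r @ w @ t'" using u'(1) by (simp add: X_def)
  then have "prefix (r @ w) (z @ v' @ w)" by simp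
  moreover have "prefix z (z @ v' @ w)" by simp
  moreover have "length (r @ w) \<le> length z" using end_in r u'(2) by (simp add: s_def)
  ultimately have "prefix (r @ w) z" by (rule prefix_length_prefix)
  then show ?thesis by (auto simp: prefix_def)
qed

text \<open>The shortest such \<open>s\<close> is what follows the last occurrence of
  \<open>w\<close>; this is meaningful when \<open>w\<close> occurs in \<open>z\<close>.\<close>

definition after_w :: "'a list \<Rightarrow> 'a list" where
  "after_w z = (ARG_MIN length s. suffix (w @ s) z)"

lemma after_w:
  assumes "sublist w z"
  shows "suffix (w @ after_w z) z" and "suffix (w @ s) z \<Longrightarrow> length (after_w z) \<le> length s"
proof -
  obtain p s where "z = p @ w @ s" using assms by (auto simp: sublist_def)
  then have "suffix (w @ s) z" by (simp add: suffix_def)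
  then show "suffix (w @ after_w z) z" unfolding after_w_def by (rule arg_min_natI)
qed (simp add: after_w_def arg_min_nat_le)

lemma after_w_eqI:
  assumes "suffix (w @ s) z" and "\<And>s'. suffix (w @ s') z \<Longrightarrow> length s \<le> length s'"
  shows "after_w z = s"
proof -
  have "sublist w z" using assms(1) by (auto simp: suffix_def)
  then have "suffix (w @ after_w z) z" "length (after_w z) = length s"
    using after_w[of z] assms by (auto intro: antisym)
  then have "w @ after_w z = w @ s"
    using assms(1) by (auto simp: suffix_def append_eq_append_conv)
  then show ?thesis by simp
qed

lemma after_w_Cons: "sublist w z \<Longrightarrow> after_w (a # z) = after_w z"
proof (rule after_w_eqI)
  assume wz: "sublist w z"
  show "suffix (w @ after_w z) (a # z)" using after_w(1)[OF wz] by (simp add: suffix_Cons)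
  show "length (after_w z) \<le> length s" if s: "suffix (w @ s) (a # z)" for s
  proof (cases "suffix (w @ s) z")
    case True
    then show ?thesis using after_w(2)[OF wz] by simp
  next
    case False
    then have "length (w @ s) = Suc (length z)" using s by (auto simp: suffix_Cons)
    moreover have "length (w @ after_w z) \<le> length z"
      using after_w(1)[OF wz] by (rule suffix_length_le)
    ultimately show ?thesis by simp
  qed
qed

lemma after_w_suffix: "suffix w z \<Longrightarrow> after_w z = []"
  by (rule after_w_eqI) auto

lemma after_w_snoc:
  assumes "sublist w z" "\<not> suffix w (z @ [b])"
  shows "after_w (z @ [b]) = after_w z @ [b]"
proof (rule after_w_eqI)
  show "suffix (w @ after_w z @ [b]) (z @ [b])"
    using after_w(1)[OF assms(1)] by (auto simp: suffix_def)
  show "length (after_w z @ [b]) \<le> length s" if s: "suffix (w @ s) (z @ [b])" for s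
  proof (cases s rule: rev_cases)
    case Nil
    then show ?thesis using s assms(2) by simp
  next
    case (snoc s' c)
    then have "suffix (w @ s') z" using s by (auto simp: suffix_def)
    then show ?thesis using after_w(2)[OF assms(1)] snoc by simp
  qed
qed

text \<open>An occurrence of \<open>w\<close> that ends before the letter \<open>b\<close> lies in
  \<open>z\<close>, so it cannot start later than the last occurrence there.\<close>

lemma after_w_return:
  assumes "sublist w z" "suffix w (z @ [b])" "z @ [b] \<in> S"
  shows "after_w z @ [b] \<in> R"
proof (rule return_wordI)
  let ?s = "after_w z"
  obtain p where p: "z = p @ w @ ?s" using after_w(1)[OF assms(1)] by (auto simp: suffix_def)
  have "z @ [b] = p @ (w @ ?s @ [b])"
    using arg_cong[OF p, of "\<lambda>x. x @ [b]"] by (simp only: append_assoc)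
  then show "w @ ?s @ [b] \<in> S" using assms(3) suffix_closed by metis
  show "?s @ [b] \<noteq> []" by simp
  have "suffix (w @ ?s @ [b]) (z @ [b])"
    using after_w(1)[OF assms(1)] by (auto simp: suffix_def)
  with assms(2) show "suffix w (w @ ?s @ [b])"
    by (rule suffix_length_suffix) simp
  show "x = [] \<or> y = []" if xy: "w @ ?s @ [b] = x @ w @ y" for x y
  proof (cases y rule: rev_cases)
    case (snoc y' c)
    then have e: "w @ ?s = x @ w @ y'" using xy by (metis append_assoc butlast_snoc)
    then have "suffix (w @ y') z" using after_w(1)[OF assms(1)] by (auto simp: suffix_def)
    then have "length ?s \<le> length y'" by (rule after_w(2)[OF assms(1)])
    then show ?thesis using arg_cong[OF e, of length] by simp
  qed simp
qed

section \<open>Right multiplication of subsets by letters\<close>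

lemma coset_mult_letters:
  assumes "Q \<subseteq> carrier G" "u \<in> lists A" "v \<in> lists A"
  shows "Q #>\<^bsub>G\<^esub> el (u @ v) = (Q #>\<^bsub>G\<^esub> el u) #>\<^bsub>G\<^esub> el v"
proof -
  interpret group G by (rule group_G)
  show ?thesis using assms el_append[of u v] el_closed by (simp add: coset_mult_assoc)
qed

lemma coset_mult_inverse:
  assumes "Q \<subseteq> carrier G" "a \<in> A"
  shows "(Q #>\<^bsub>G\<^esub> el [a]) #>\<^bsub>G\<^esub> el [\<theta> a] = Q" "(Q #>\<^bsub>G\<^esub> el [\<theta> a]) #>\<^bsub>G\<^esub> el [a] = Q"
proof -
  interpret group G by (rule group_G)
  have "[a] \<in> lists A" "[\<theta> a] \<in> lists A" using assms(2) theta_closed by auto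
  moreover have "el [\<theta> a] \<otimes>\<^bsub>G\<^esub> el [a] = \<one>\<^bsub>G\<^esub>"
    using el_mult_theta[of "\<theta> a"] assms(2) by (simp add: theta_closed theta_theta)
  ultimately show "(Q #>\<^bsub>G\<^esub> el [a]) #>\<^bsub>G\<^esub> el [\<theta> a] = Q" "(Q #>\<^bsub>G\<^esub> el [\<theta> a]) #>\<^bsub>G\<^esub> el [a] = Q"
    using assms el_closed el_mult_theta by (simp_all add: coset_mult_assoc)
qed

text \<open>Reading a letter multiplies the coset of the part after the last \<open>w\<close>, and a
  completed return word is absorbed by \<open>H\<close>. Independence of the earlier letters lets
  the two trees alone track this action.\<close>

lemma even_subset_generate: "carrier (even_subgroup A \<theta> S) \<subseteq> generate G (el ` R)"
proof -
  interpret group G by (rule group_G)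
  define H where "H = generate G (el ` R)"
  have el_R: "el ` R \<subseteq> carrier G" using el_closed return_word_letters by blast
  have H: "subgroup H G" unfolding H_def using el_R by (rule generate_is_subgroup)
  then have Hc: "H \<subseteq> carrier G" by (rule subgroup.subset)
  define act where "act b Q = Q #>\<^bsub>G\<^esub> el [b]" for b Q
  have act_inj: "inj_on (act b) (Pow (carrier G))" if "b \<in> A" for b
    by (rule inj_on_inverseI[of _ "act (\<theta> b)"]) (use that coset_mult_inverse in \<open>simp add: act_def\<close>)
  have act_closed: "act b Q \<subseteq> carrier G" if "b \<in> A" "Q \<subseteq> carrier G" for b Q
    unfolding act_def using that el_closed[of "[b]"] by (intro r_coset_subset_G) auto
  \<comment> \<open>The default \<open>H\<close> keeps \<open>c\<close> among the subsets of
    \<open>G\<close>, as \<open>transition_last\<close> requires on all of \<open>S\<close>.\<close>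
  define c where "c z = (if sublist w z then H #>\<^bsub>G\<^esub> el (after_w z) else H)" for z
  have after_lists: "after_w z \<in> lists A" if "z \<in> S" "sublist w z" for z
    using set_mono_suffix[OF after_w(1)[OF that(2)]] alphabet[OF that(1)]
    by (auto simp: lists_eq_set)
  have c_closed: "c z \<in> Pow (carrier G)" if "z \<in> S" for z
    using Hc after_lists[OF that] el_closed r_coset_subset_G by (auto simp: c_def)
  have c_snoc: "c (z @ [b]) = act b (c z)" if zb: "z @ [b] \<in> S" and wz: "sublist w z" for z b
  proof -
    have "z \<in> S" using zb by (rule prefix_closed)
    have lists: "after_w z \<in> lists A" "[b] \<in> lists A"
      using after_lists[OF \<open>z \<in> S\<close> wz] alphabet[OF zb] by auto
    have wzb: "sublist w (z @ [b])" using wz by (auto simp: sublist_append)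
    have act_c: "act b (c z) = H #>\<^bsub>G\<^esub> el (after_w z @ [b])"
      using wz lists Hc by (simp add: act_def c_def coset_mult_letters)
    show ?thesis
    proof (cases "suffix w (z @ [b])")
      case True
      then have "el (after_w z @ [b]) \<in> H"
        unfolding H_def using after_w_return[OF wz True zb] by (intro generate.incl) blast
      then have "H #>\<^bsub>G\<^esub> el (after_w z @ [b]) = H"
        using Hc by (intro coset_join2 H) auto
      then show ?thesis
        using act_c wzb after_w_suffix[OF True] Hc by (simp add: c_def el_Nil coset_mult_one)
    next
      case False
      then show ?thesis using act_c wzb after_w_snoc[OF wz False] by (simp add: c_def)
    qed
  qed
  obtain M where M: "\<And>y. y \<in> R \<Longrightarrow> length (w @ y) \<le> M"
    using finite_return_words finite_nat_set_iff_bounded_le[of "(\<lambda>y. length (w @ y)) ` R"] by auto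
  \<comment> \<open>At least \<open>M\<close>, so that words of length \<open>n\<close> contain
    \<open>w\<close>, and at least \<open>length w\<close>, so that \<open>w\<close> can be padded
    to length \<open>Suc n\<close>.\<close>
  define n where "n = M + length w"
  have long: "sublist w z" if "z \<in> S" "n \<le> length z" for z
    using long_word_contains_w[OF M] that by (simp add: n_def)
  \<comment> \<open>Without its first letter the word still contains \<open>w\<close>, so the
    deletion leaves the last occurrence in place.\<close>
  have transition: "c (tl (z @ [b])) = act b (c z)" if zb: "z @ [b] \<in> S" "length z = Suc n" for z b
  proof -
    obtain a v where z: "z = a # v" using zb(2) by (cases z) auto
    have "v @ [b] \<in> S" using zb(1) z tl_closed by simp
    moreover from this have "v \<in> S" by (rule prefix_closed)
    ultimately have wv: "sublist w v" using zb(2) z by (intro long) auto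
    then have "c (v @ [b]) = act b (c v)" using c_snoc \<open>v @ [b] \<in> S\<close> by blast
    moreover have "c (a # v) = c v"
      using wv after_w_Cons by (auto simp: c_def sublist_Cons_right)
    ultimately show ?thesis using z by simp
  qed
  have c_last: "c z = c z'"
    if "z \<in> S" "z' \<in> S" "length z = Suc n" "length z' = Suc n" "last z = last z'" for z z'
    using transition_last[of c "Pow (carrier G)" act n z z'] c_closed act_inj transition that by blast
  define d where "d a = c (SOME z. z \<in> S \<and> length z = Suc n \<and> last z = a)" for a
  have d: "d (last z) = c z" if "z \<in> S" "length z = Suc n" for z
  proof -
    let ?z = "SOME z'. z' \<in> S \<and> length z' = Suc n \<and> last z' = last z"
    have "?z \<in> S \<and> length ?z = Suc n \<and> last ?z = last z"
      by (rule someI[of _ z]) (use that in simp)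
    then show ?thesis unfolding d_def using that c_last by blast
  qed
  have d_closed: "d a \<subseteq> carrier G" if a: "a \<in> A" for a
  proof -
    obtain t where "length t = n" "t @ [a] \<in> S" using extend_left_length[OF letter[OF a]] by blast
    then show ?thesis using d[of "t @ [a]"] c_closed by auto
  qed
  have d_edge: "d b = act b (d a)" if ab: "[a, b] \<in> S" for a b
  proof -
    obtain t where t: "length t = n" "t @ [a, b] \<in> S" using extend_left_length[OF ab] by blast
    have "t @ [a] \<in> S" "tl ((t @ [a]) @ [b]) \<in> S"
      using t(2) prefix_closed[of "t @ [a]" "[b]"] suffix_closed[of "take 1 t" "tl t @ [a, b]"]
        suffix_closed[of "[a]" "[b]"] ab by (cases t; auto)+
    moreover have "last (tl ((t @ [a]) @ [b])) = b" by (cases t) auto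
    ultimately show ?thesis
      using d[of "t @ [a]"] d[of "tl ((t @ [a]) @ [b])"] transition[of "t @ [a]" b] t by simp
  qed
  have d_w: "d (last w) = H"
  proof -
    obtain t where t: "length t = Suc n - length w" "t @ w \<in> S" using extend_left_length[OF w] by blast
    have "length (t @ w) = Suc n" using t(1) by (simp add: n_def)
    moreover have "c (t @ w) = H"
      using after_w_suffix[of "t @ w"] Hc by (auto simp: c_def el_Nil coset_mult_one suffix_def)
    ultimately show ?thesis using d[OF t(2)] w_nonempty by simp
  qed
  \<comment> \<open>At a right vertex this is the set before \<open>b\<close> is read, obtained by
    undoing \<open>act b\<close>; hence it agrees along edges.\<close>
  define \<kappa> where "\<kappa> v = (case v of Inl a \<Rightarrow> d a | Inr b \<Rightarrow> act (\<theta> b) (d b))" for v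
  have \<kappa>_connected: "\<kappa> x = \<kappa> y" if "connected_in (E []) x y" for x y
    using that
  proof (rule connected_in_invariant)
    have edge: "\<kappa> (Inl a) = \<kappa> (Inr b)" if "[a, b] \<in> S" for a b
    proof -
      have "a \<in> A" "b \<in> A" using alphabet[OF that] by auto
      then show ?thesis
        using d_edge[OF that] coset_mult_inverse d_closed by (simp add: \<kappa>_def act_def)
    qed
    show "\<kappa> u = \<kappa> v" if "{u, v} \<in> snd (E [])" for u v
      using that by (auto simp: edge_iff edge)
  qed
  define k where "k i = \<kappa> (SOME v. v \<in> fst (E []) \<and> state v = i)" for i
  have k: "\<kappa> v = k (state v)" if "v \<in> fst (E [])" for v
  proof -
    let ?v = "SOME u. u \<in> fst (E []) \<and> state u = state v"
    have "?v \<in> fst (E []) \<and> state ?v = state v"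
      by (rule someI[of _ v]) (use that in simp)
    then show ?thesis
      unfolding k_def using that by (intro \<kappa>_connected) (simp add: connected_iff_state)
  qed
  have k_Inl: "k (state (Inl a)) = d a" if "a \<in> A" for a
    using k[of "Inl a"] that vertex by (simp add: \<kappa>_def)
  have k_Inr: "act a (k (state (Inr a))) = d a" if "a \<in> A" for a
    using k[of "Inr a", symmetric] that vertex coset_mult_inverse(2)[OF d_closed[OF that] that]
    by (simp add: \<kappa>_def act_def)
  have k_closed: "k i \<subseteq> carrier G" for i
  proof -
    \<comment> \<open>Inversion supplies a vertex in the second tree, so each \<open>k i\<close> is
      the value at an actual vertex.\<close>
    have "state (Inl (last w)) \<noteq> state (Inr (\<theta> (last w)))" using state_inverse last_w by simp
    moreover have "k (state (Inr (\<theta> (last w)))) = act (\<theta> (\<theta> (last w))) (d (\<theta> (last w)))"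
      using k[of "Inr (\<theta> (last w))"] last_w vertex theta_closed by (simp add: \<kappa>_def)
    ultimately show ?thesis
      using k_Inl[OF last_w] d_closed act_closed last_w theta_closed theta_theta
      by (cases "i = state (Inl (last w))") auto
  qed
  have k_act: "act a (k i) = k (i = even_letter A S a)" if "a \<in> A" for a i
  proof (cases "i = state (Inr a)")
    case True
    then have "(i = even_letter A S a) = state (Inl a)"
      using that by (auto simp: even_letter_iff_state)
    then show ?thesis using True k_Inl k_Inr that by simp
  next
    case False
    \<comment> \<open>Here \<open>\<theta> a\<close>, read in the state of its own right vertex,
      leads from the claimed target to \<open>k i\<close>; multiplying by \<open>a\<close> undoes
      it.\<close>
    have "act (\<theta> a) (k (state (Inr (\<theta> a)))) = k (state (Inl (\<theta> a)))"
      using k_Inl k_Inr that theta_closed by simp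
    moreover have "state (Inl (\<theta> a)) = i" using False that by (auto simp: state_inverse')
    moreover have "state (Inr (\<theta> a)) = (i = even_letter A S a)"
      using False that by (auto simp: even_letter_iff_state state_inverse)
    ultimately have "act (\<theta> a) (k (i = even_letter A S a)) = k i" by simp
    then show ?thesis
      using coset_mult_inverse(2)[OF k_closed that] by (metis act_def)
  qed
  have k_word: "k i #>\<^bsub>G\<^esub> el u = k (i = even_word A S u)" if "u \<in> lists A" for i u
    using that
  proof (induction u arbitrary: i rule: list.induct)
    case Nil
    then show ?case using k_closed by (simp add: el_Nil coset_mult_one even_word_simps)
  next
    case (Cons a u)
    then have au: "a \<in> A" "u \<in> lists A" by auto
    then have "k i #>\<^bsub>G\<^esub> el (a # u) = act a (k i) #>\<^bsub>G\<^esub> el u"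
      using coset_mult_letters[OF k_closed, of "[a]" u i] by (simp add: act_def)
    also have "\<dots> = k ((i = even_letter A S a) = even_word A S u)"
      using k_act au Cons.IH by simp
    also have "((i = even_letter A S a) = even_word A S u) = (i = even_word A S (a # u))"
      by (auto simp: even_word_simps)
    finally show ?case .
  qed
  have "k True = H" using k_Inl[OF last_w] state_root d_w by simp
  \<comment> \<open>An even word maps \<open>k True\<close>, which is \<open>H\<close>, to itself,
    and a coset of \<open>el u\<close> equal to \<open>H\<close> forces \<open>el u\<close> into
    \<open>H\<close>.\<close>
  have "el u \<in> H" if u: "u \<in> lists A" "even_word A S u" for u
    using k_word[OF u(1), of True] u \<open>k True = H\<close> H el_closed[OF u(1)] coset_join1[of H "el u"] Hc
    by simp
  then show ?thesis by (auto simp: even_subgroup_def H_def)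
qed

end

section \<open>Bases\<close>

definition gword_eval :: "('g, 'm) monoid_scheme \<Rightarrow> 'g gword \<Rightarrow> 'g" where
  "gword_eval H u = foldr (\<lambda>(x, e) p. (if e then x else inv\<^bsub>H\<^esub> x) \<otimes>\<^bsub>H\<^esub> p) u \<one>\<^bsub>H\<^esub>"

context group
begin

lemma gword_eval_closed: "X \<subseteq> carrier G \<Longrightarrow> u \<in> gwords X \<Longrightarrow> gword_eval G u \<in> carrier G"
  by (induction u) (auto simp: gword_eval_def)

lemma gword_eval_append:
  "X \<subseteq> carrier G \<Longrightarrow> u \<in> gwords X \<Longrightarrow> v \<in> gwords X \<Longrightarrow>
    gword_eval G (u @ v) = gword_eval G u \<otimes> gword_eval G v"
proof (induction u)
  case Nil
  then show ?case using gword_eval_closed[of X v] by (simp add: gword_eval_def)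
next
  case (Cons p u)
  obtain x e where p: "p = (x, e)" by (cases p)
  have xu: "x \<in> carrier G" "u \<in> gwords X" using Cons.prems p by auto
  have step: "gword_eval G (p # t) = (if e then x else inv x) \<otimes> gword_eval G t" for t
    by (simp add: p gword_eval_def)
  have "gword_eval G u \<in> carrier G" "gword_eval G v \<in> carrier G"
    using gword_eval_closed Cons.prems xu by auto
  then show ?case
    using Cons.IH[OF Cons.prems(1) xu(2) Cons.prems(3)] xu(1) by (simp add: step m_assoc)
qed

lemma gword_eval_pres_eq:
  assumes X: "X \<subseteq> carrier G"
  shows "pres_eq X {} u v \<Longrightarrow> gword_eval G u = gword_eval G v"
proof (induction rule: pres_eq.induct)
  case (cancel u v x e)
  have "gword_eval G [(x, e), (x, \<not> e)] = \<one>"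
    using cancel X by (auto simp: gword_eval_def)
  moreover have "[(x, e), (x, \<not> e)] \<in> gwords X" using cancel by simp
  ultimately show ?case
    using cancel gword_eval_append[OF X] gword_eval_closed[OF X] by (simp del: append_Cons)
qed simp_all

text \<open>Evaluation of group words is the homomorphism that extends the inclusion of
  \<open>X\<close>. It is onto because \<open>X\<close> generates, and one-to-one because
  \<open>F\<close> is a left inverse.\<close>

lemma is_basisI:
  assumes X: "X \<subseteq> carrier G" and gen: "carrier G \<subseteq> generate G X"
    and F: "F \<in> hom G (free_group X)" "\<And>x. x \<in> X \<Longrightarrow> F x = pres_class X {} [(x, True)]"
  shows "is_basis G X"
proof -
  interpret FG: group "free_group X"
    unfolding free_group_def by (rule group_presented_group)
  interpret F: group_hom G "free_group X" F
    using F(1) by unfold_locales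
  let ?cl = "pres_class X {}"
  have carr: "carrier (free_group X) = ?cl ` gwords X"
    and one: "\<one>\<^bsub>free_group X\<^esub> = ?cl []"
    by (simp_all add: free_group_def presented_group_def)
  have mult: "?cl u \<otimes>\<^bsub>free_group X\<^esub> ?cl v = ?cl (u @ v)" if "u \<in> gwords X" "v \<in> gwords X" for u v
    using presented_group_mult[OF that] by (simp add: free_group_def)
  \<comment> \<open>Any representative of a class serves, by
    \<open>gword_eval_pres_eq\<close>.\<close>
  define h where "h P = gword_eval G (SOME v. v \<in> P)" for P
  have h: "h (?cl u) = gword_eval G u" if "u \<in> gwords X" for u
  proof -
    have "u \<in> ?cl u" using that by (auto simp: pres_class_def intro: pres_eq.refl)
    then have "(SOME v. v \<in> ?cl u) \<in> ?cl u" by (rule someI)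
    then have "pres_eq X {} u (SOME v. v \<in> ?cl u)" by (simp add: pres_class_def)
    then show ?thesis unfolding h_def using gword_eval_pres_eq[OF X] by simp
  qed
  have h_letter: "h (?cl [(x, True)]) = x" if "x \<in> X" for x
    using that X h[of "[(x, True)]"] by (auto simp: gword_eval_def)
  have F_eval: "F (gword_eval G u) = ?cl u" if "u \<in> gwords X" for u
    using that
  proof (induction u rule: list.induct)
    case Nil
    then show ?case using F.hom_one one by (simp add: gword_eval_def)
  next
    case (Cons p u)
    obtain x e where p: "p = (x, e)" by (cases p)
    then have x: "x \<in> X" "x \<in> carrier G" and u: "u \<in> gwords X" using Cons X by auto
    have "inv\<^bsub>free_group X\<^esub> ?cl [(x, True)] = ?cl [(x, False)]"
    proof (rule FG.inv_equality)
      have "pres_eq X {} ([] @ [(x, False), (x, \<not> False)] @ []) ([] @ [])"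
        using x by (intro pres_eq.cancel) auto
      then have "?cl [(x, False), (x, True)] = ?cl []"
        using x pres_class_eq_iff[of "[(x, False), (x, True)]" X "{}" "[]"] by simp
      then show "?cl [(x, False)] \<otimes>\<^bsub>free_group X\<^esub> ?cl [(x, True)] = \<one>\<^bsub>free_group X\<^esub>"
        using mult[of "[(x, False)]" "[(x, True)]"] x one by simp
    qed (use x in \<open>auto simp: carr\<close>)
    then have "F (if e then x else inv x) = ?cl [p]"
      using F(2)[OF x(1)] x(2) p by simp
    moreover have "gword_eval G (p # u) = (if e then x else inv x) \<otimes> gword_eval G u"
      by (simp add: p gword_eval_def)
    ultimately have "F (gword_eval G (p # u)) = ?cl [p] \<otimes>\<^bsub>free_group X\<^esub> ?cl u"
      using Cons.IH[OF u] x(2) gword_eval_closed[OF X u] by (cases e) simp_all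
    also have "\<dots> = ?cl (p # u)" using mult[of "[p]" u] u x(1) p by simp
    finally show ?case .
  qed
  have "h \<in> hom (free_group X) G"
  proof (rule homI)
    show "h P \<in> carrier G" if P: "P \<in> carrier (free_group X)" for P
    proof -
      obtain u where "P = ?cl u" "u \<in> gwords X" using P unfolding carr by blast
      then show ?thesis using h gword_eval_closed[OF X] by simp
    qed
    show "h (P \<otimes>\<^bsub>free_group X\<^esub> Q) = h P \<otimes> h Q"
      if PQ: "P \<in> carrier (free_group X)" "Q \<in> carrier (free_group X)" for P Q
    proof -
      obtain u v where uv: "P = ?cl u" "u \<in> gwords X" "Q = ?cl v" "v \<in> gwords X"
        using PQ unfolding carr by blast
      then have "u @ v \<in> gwords X" by (simp only: append_in_lists_conv)
      then show ?thesis using uv mult h gword_eval_append[OF X] by simp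
    qed
  qed
  moreover have "inj_on h (carrier (free_group X))"
  proof (rule inj_on_inverseI[of _ F])
    fix P assume "P \<in> carrier (free_group X)"
    then obtain u where "P = ?cl u" "u \<in> gwords X" unfolding carr by blast
    then show "F (h P) = P" by (simp add: h F_eval)
  qed
  moreover have "carrier G \<subseteq> h ` carrier (free_group X)"
  proof
    fix g assume "g \<in> carrier G"
    then have "g \<in> generate G X" using gen by blast
    then have "\<exists>u\<in>gwords X. g = gword_eval G u"
    proof (induction rule: generate.induct)
      case one
      show ?case by (intro bexI[of _ "[]"]) (auto simp: gword_eval_def)
    next
      case (incl x)
      then show ?case using X by (intro bexI[of _ "[(x, True)]"]) (auto simp: gword_eval_def)
    next
      case (inv x)
      then show ?case using X by (intro bexI[of _ "[(x, False)]"]) (auto simp: gword_eval_def)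
    next
      case (eng a b)
      then obtain u v where uv: "u \<in> gwords X" "a = gword_eval G u" "v \<in> gwords X" "b = gword_eval G v"
        by blast
      then have "u @ v \<in> gwords X" by (simp only: append_in_lists_conv)
      then show ?case using uv gword_eval_append[OF X] by (intro bexI[of _ "u @ v"]) simp_all
    qed
    then obtain u where "u \<in> gwords X" "g = h (?cl u)" using h by metis
    then show "g \<in> h ` carrier (free_group X)" unfolding carr by blast
  qed
  ultimately have "h \<in> iso (free_group X) G"
    by (auto simp: iso_def bij_betw_def hom_def)
  then show ?thesis using X h_letter unfolding is_basis_def by blast
qed

end

theorem theorem6p15:
  fixes A :: "'a set" and \<theta> :: "'a \<Rightarrow> 'a" and S :: "'a list set" and w :: "'a list"
  assumes "finite A"
    and "involution_on A \<theta>"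
    and "specular_set A \<theta> S"
    and "recurrent A S"
    and "w \<in> S"
    and "w \<noteq> []"
  shows "is_basis (even_subgroup A \<theta> S) (word_elem A \<theta> ` right_return_words S w)"
proof -
  interpret recurrent_specular A \<theta> S w
    using assms by unfold_locales
  interpret G: group G by (rule group_G)
  let ?H = "even_subgroup A \<theta> S"
  have H_def: "?H = G\<lparr>carrier := carrier ?H\<rparr>" by (simp add: even_subgroup_def)
  interpret H: group ?H
    using G.subgroup_imp_group[OF subgroup_even] H_def by simp
  have X: "el ` R \<subseteq> carrier ?H"
    using return_word_letters return_word_even by (auto simp: even_subgroup_def)
  have "generate ?H (el ` R) = generate G (el ` R)"
    using G.generate_consistent[OF X subgroup_even] H_def by simp
  then have gen: "carrier ?H \<subseteq> generate ?H (el ` R)"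
    using even_subset_generate by simp
  \<comment> \<open>As \<open>R\<close> is finite, one bound covers all return words and discharges
    the length condition of \<open>return_words_hom\<close>.\<close>
  obtain M where M: "\<And>y. y \<in> R \<Longrightarrow> length (w @ y) \<le> M"
    using finite_return_words finite_nat_set_iff_bounded_le[of "(\<lambda>y. length (w @ y)) ` R"] by auto
  \<comment> \<open>Each return word is sent to its own generator of the free group, so the
    homomorphism obtained inverts evaluation. The unit outside \<open>R\<close> keeps
    \<open>f\<close> within the carrier.\<close>
  define f where "f y = (if y \<in> R then pres_class (el ` R) {} [(el y, True)]
    else \<one>\<^bsub>free_group (el ` R)\<^esub>)" for y
  have f: "f y \<in> carrier (free_group (el ` R))" for y
    by (auto simp: f_def free_group_def presented_group_def)
  have "group (free_group (el ` R))"
    unfolding free_group_def by (rule group_presented_group)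
  from return_words_hom[OF this, of f M, OF f] obtain F where F: "F \<in> hom ?H (free_group (el ` R))"
    "\<forall>y\<in>R. length (w @ y) \<le> Suc M \<longrightarrow> F (el y) = f y"
    by blast
  show ?thesis
  proof (rule H.is_basisI[OF X gen F(1)])
    fix x assume "x \<in> el ` R"
    then obtain y where "y \<in> R" "x = el y" by blast
    then show "F x = pres_class (el ` R) {} [(x, True)]"
      using F(2) M[of y] by (simp add: f_def)
  qed
qed

end
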